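(* Let $T:X\to Y$ be a bijective linear operator between Archimedean vector lattices satisfying at least one of the following: (1) $X$ and $Y$ are Banach lattices; (2) $X$ is relatively uniformly complete and $Y$ is a normed vector lattice; (3) $X$ is a Dedekind $\sigma$-complete normed vector lattice and $Y$ is relatively uniformly complete; (4) $X$ is a Dedekind $\sigma$-complete normed vector lattice and $Y=X$. Then $T$ is disjointness preserving if and only if $T$ satisfies condition $(\beta)$.
   Context: All vector lattices are Archimedean; operators are not assumed continuous. For a subset $A$ of a vector lattice $X$, $A^d=\{x\in X: |x|\wedge|a|=0 \text{ for all } a\in A\}$ and $A^{dd}=(A^d)^d$. For $a,b\in X$ we write $a\lhd b$ if $\{a\}^{dd}\subseteq\{b\}^{dd}$. A linear operator $S$ satisfies condition $(\beta)$ if $Sa\lhd Sb$ whenever $a\lhd b$. A linear operator is disjointness preserving if it maps disjoint elements to disjoint elements. A vector lattice is relatively uniformly ($(r_u)$-) complete if every relatively uniformly Cauchy sequence is relatively uniformly convergent. *)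

theory Defs
  imports "HOL-Analysis.Analysis"
begin

text \<open>A (real) vector lattice (Riesz space) is modelled as a type of sort
  {ordered_real_vector, lattice}: an ordered real vector space whose order is a lattice.\<close>

definition vabs :: "'a::{ordered_real_vector, lattice} \<Rightarrow> 'a" where
  "vabs x = sup x (- x)"

definition vdisj :: "'a::{ordered_real_vector, lattice} \<Rightarrow> 'a \<Rightarrow> bool" where
  "vdisj x y \<longleftrightarrow> inf (vabs x) (vabs y) = 0"

definition dcompl :: "'a::{ordered_real_vector, lattice} set \<Rightarrow> 'a set" where
  "dcompl A = {x. \<forall>a\<in>A. vdisj x a}"

definition band_le :: "'a::{ordered_real_vector, lattice} \<Rightarrow> 'a \<Rightarrow> bool" where
  "band_le a b \<longleftrightarrow> dcompl (dcompl {a}) \<subseteq> dcompl (dcompl {b})"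

definition archimedean_vl :: "'a::{ordered_real_vector, lattice} itself \<Rightarrow> bool" where
  "archimedean_vl _ \<longleftrightarrow>
     (\<forall>x y::'a. 0 \<le> x \<and> (\<forall>n::nat. real n *\<^sub>R x \<le> y) \<longrightarrow> x = 0)"

definition disjointness_preserving ::
  "('a::{ordered_real_vector, lattice} \<Rightarrow> 'b::{ordered_real_vector, lattice}) \<Rightarrow> bool" where
  "disjointness_preserving T \<longleftrightarrow> (\<forall>x y. vdisj x y \<longrightarrow> vdisj (T x) (T y))"

definition condition_beta ::
  "('a::{ordered_real_vector, lattice} \<Rightarrow> 'b::{ordered_real_vector, lattice}) \<Rightarrow> bool" where
  "condition_beta T \<longleftrightarrow> (\<forall>a b. band_le a b \<longrightarrow> band_le (T a) (T b))"

definition lattice_norm :: "('a::{ordered_real_vector, lattice} \<Rightarrow> real) \<Rightarrow> bool" where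
  "lattice_norm N \<longleftrightarrow>
     (\<forall>x. N x = 0 \<longleftrightarrow> x = 0) \<and>
     (\<forall>x y. N (x + y) \<le> N x + N y) \<and>
     (\<forall>c x. N (c *\<^sub>R x) = \<bar>c\<bar> * N x) \<and>
     (\<forall>x y. vabs x \<le> vabs y \<longrightarrow> N x \<le> N y)"

definition norm_complete :: "('a::{ordered_real_vector, lattice} \<Rightarrow> real) \<Rightarrow> bool" where
  "norm_complete N \<longleftrightarrow>
     (\<forall>s::nat \<Rightarrow> 'a. (\<forall>e>0. \<exists>K. \<forall>m\<ge>K. \<forall>n\<ge>K. N (s m - s n) < e) \<longrightarrow>
        (\<exists>l. \<forall>e>0. \<exists>K. \<forall>n\<ge>K. N (s n - l) < e))"

definition banach_lattice_norm :: "('a::{ordered_real_vector, lattice} \<Rightarrow> real) \<Rightarrow> bool" where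
  "banach_lattice_norm N \<longleftrightarrow> lattice_norm N \<and> norm_complete N"

definition ru_cauchy :: "(nat \<Rightarrow> 'a::{ordered_real_vector, lattice}) \<Rightarrow> bool" where
  "ru_cauchy s \<longleftrightarrow> (\<exists>u\<ge>0. \<forall>e>0. \<exists>K. \<forall>m\<ge>K. \<forall>n\<ge>K. vabs (s m - s n) \<le> e *\<^sub>R u)"

definition ru_converges :: "(nat \<Rightarrow> 'a::{ordered_real_vector, lattice}) \<Rightarrow> 'a \<Rightarrow> bool" where
  "ru_converges s l \<longleftrightarrow> (\<exists>u\<ge>0. \<forall>e>0. \<exists>K. \<forall>n\<ge>K. vabs (s n - l) \<le> e *\<^sub>R u)"

definition ru_complete :: "'a::{ordered_real_vector, lattice} itself \<Rightarrow> bool" where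
  "ru_complete _ \<longleftrightarrow> (\<forall>s::nat \<Rightarrow> 'a. ru_cauchy s \<longrightarrow> (\<exists>l. ru_converges s l))"

definition dedekind_sigma_complete :: "'a::{ordered_real_vector, lattice} itself \<Rightarrow> bool" where
  "dedekind_sigma_complete _ \<longleftrightarrow>
     (\<forall>A::'a set. countable A \<and> A \<noteq> {} \<and> (\<exists>u. \<forall>a\<in>A. a \<le> u) \<longrightarrow>
        (\<exists>l. (\<forall>a\<in>A. a \<le> l) \<and> (\<forall>u. (\<forall>a\<in>A. a \<le> u) \<longrightarrow> l \<le> u)))"

text \<open>Riesz (vector lattice) isomorphism, used to express "Y = X".\<close>
definition riesz_iso ::
  "('a::{ordered_real_vector, lattice} \<Rightarrow> 'b::{ordered_real_vector, lattice}) \<Rightarrow> bool" where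
  "riesz_iso J \<longleftrightarrow> linear J \<and> bij J \<and> (\<forall>x y. J x \<le> J y \<longleftrightarrow> x \<le> y)"

end

theory Submission
  imports Defs
begin

text \<open>An injective operator with condition (\<open>\<beta>\<close>) reflects disjointness, since
  \<open>\<bar>a\<bar> \<sqinter> \<bar>b\<bar>\<close> lies in the bands of \<open>a\<close> and \<open>b\<close>; a surjective one that preserves and reflects
  disjointness satisfies (\<open>\<beta>\<close>). So everything rests on two facts for a bijective \<open>T: X \<rightarrow> Y\<close> with \<open>X\<close>
  relatively uniformly complete and \<open>Y\<close> normed, both obtained by a gliding hump.

  If \<open>T\<close> preserves disjointness, then \<open>T\<close> is bounded on \<open>[-x, x]\<close> for some \<open>0 < x \<le> c\<close>, for every
  \<open>c > 0\<close>. There \<open>T\<close> is monotone in absolute value, hence it reflects disjointness.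

  If \<open>T\<close> satisfies (\<open>\<beta>\<close>) but does not preserve disjointness, there are disjoint \<open>a \<noteq> 0\<close> and \<open>b\<close> with
  \<open>0 \<le> T a \<le> T b\<close>, and \<open>b\<close> can be chosen with \<open>T\<close> bounded on \<open>[-\<bar>b\<bar>, \<bar>b\<bar>]\<close>. Condition (\<open>\<beta>\<close>) turns the spectral
  pieces of \<open>T a\<close> relative to \<open>T b\<close> into images of components \<open>b\<^sub>k\<close> of \<open>b\<close>, and the binary expansion of
  \<open>T a / T b\<close> gives \<open>T a = T (\<Sum>k. 2\<^sup>-\<^sup>k b\<^sub>k)\<close>. Then \<open>a\<close> is in the band of \<open>b\<close>, so \<open>a = 0\<close>.

  On a Dedekind \<open>\<sigma>\<close>-complete \<open>X\<close> band projections show that the inverse of a disjointness preserving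
  bijection satisfies (\<open>\<beta>\<close>), which exchanges the roles of \<open>X\<close> and \<open>Y\<close>.\<close>

section \<open>Vector lattices\<close>

lemma sup_add_right: "sup x y + z = sup (x + z) (y + z)"
  for x y z :: "'a::{ordered_real_vector, lattice}"
proof (rule antisym)
  have "sup x y \<le> sup (x + z) (y + z) - z"
    by (rule le_supI) (simp_all add: le_diff_eq)
  then show "sup x y + z \<le> sup (x + z) (y + z)"
    by (simp add: le_diff_eq)
qed (simp add: le_supI)

lemma neg_sup_eq: "- sup x y = inf (- x) (- y)"
  for x y :: "'a::{ordered_real_vector, lattice}"
proof (rule antisym)
  have "x \<le> - inf (- x) (- y)" "y \<le> - inf (- x) (- y)"
    by (subst le_minus_iff, simp)+
  then have "sup x y \<le> - inf (- x) (- y)"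
    by (rule le_supI)
  then show "inf (- x) (- y) \<le> - sup x y"
    by (subst le_minus_iff)
qed simp

lemma neg_inf_eq: "- inf x y = sup (- x) (- y)"
  for x y :: "'a::{ordered_real_vector, lattice}"
  using neg_sup_eq[of "- x" "- y"] by (simp add: minus_equation_iff)

lemma inf_add_right: "inf x y + z = inf (x + z) (y + z)"
  for x y z :: "'a::{ordered_real_vector, lattice}"
proof -
  have "- (inf x y + z) = - inf (x + z) (y + z)"
    using sup_add_right[of "- x" "- y" "- z"] by (simp add: neg_inf_eq)
  then show ?thesis
    by (simp only: neg_equal_iff_equal)
qed

lemma sup_plus_inf: "sup x y + inf x y = x + y"
  for x y :: "'a::{ordered_real_vector, lattice}"
proof -
  have "sup x y + - (x + y) = sup (- y) (- x)"
    by (simp add: sup_add_right)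
  also have "\<dots> = - inf x y"
    by (simp add: neg_inf_eq sup_commute)
  finally show ?thesis
    by (simp add: algebra_simps)
qed

text \<open>The difference of \<open>inf x (y + z)\<close> and \<open>inf x y\<close> lies below
  \<open>z\<close> by translation, and below \<open>x\<close> because \<open>inf x y\<close> is
  nonnegative.\<close>

lemma inf_add_le:
  fixes x y z :: "'a::{ordered_real_vector, lattice}"
  assumes "0 \<le> x" "0 \<le> y" "0 \<le> z"
  shows "inf x (y + z) \<le> inf x y + inf x z"
proof -
  have "inf x (y + z) \<le> inf x y + z"
    unfolding inf_add_right using assms by (intro le_infI) (auto intro: order_trans[OF inf_le1] simp: add_increasing2)
  then have "inf x (y + z) - inf x y \<le> z"
    by (simp add: algebra_simps)
  moreover have "inf x (y + z) - inf x y \<le> x - 0"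
    using assms by (intro diff_mono) auto
  ultimately have "inf x (y + z) - inf x y \<le> inf x z"
    by (intro le_infI) simp_all
  then show ?thesis
    by (simp only: diff_le_eq add.commute)
qed

lemma pos_minus_neg: "sup x 0 - sup (- x) 0 = x"
  for x :: "'a::{ordered_real_vector, lattice}"
  using sup_add_right[of x 0 "- x"] by (simp add: sup_commute algebra_simps)

lemma double_nonneg_imp: "0 \<le> x + x \<Longrightarrow> 0 \<le> x"
  for x :: "'a::{ordered_real_vector, lattice}"
  using scaleR_left_mono[of 0 "x + x" "1/2"] by (simp flip: scaleR_2)

lemma le_vabs: "x \<le> vabs x"
  for x :: "'a::{ordered_real_vector, lattice}"
  unfolding vabs_def by (rule sup_ge1)

lemma neg_le_vabs: "- x \<le> vabs x"
  for x :: "'a::{ordered_real_vector, lattice}"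
  unfolding vabs_def by (rule sup_ge2)

lemma vabs_nonneg [simp]: "0 \<le> vabs x"
  for x :: "'a::{ordered_real_vector, lattice}"
  by (rule double_nonneg_imp) (use add_mono[OF le_vabs[of x] neg_le_vabs[of x]] in simp)

lemma vabs_leI: "x \<le> y \<Longrightarrow> - x \<le> y \<Longrightarrow> vabs x \<le> y"
  for x y :: "'a::{ordered_real_vector, lattice}"
  by (simp add: vabs_def)

lemma vabs_of_nonneg: "0 \<le> x \<Longrightarrow> vabs x = x"
  for x :: "'a::{ordered_real_vector, lattice}"
  by (simp add: vabs_def sup_absorb1 order_trans[of "- x" 0 x])

lemma vabs_minus [simp]: "vabs (- x) = vabs x"
  for x :: "'a::{ordered_real_vector, lattice}"
  by (simp add: vabs_def sup_commute)

lemma vabs_zero [simp]: "vabs 0 = (0 :: 'a::{ordered_real_vector, lattice})"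
  by (simp add: vabs_def)

lemma vabs_vabs [simp]: "vabs (vabs x) = vabs x"
  for x :: "'a::{ordered_real_vector, lattice}"
  by (simp add: vabs_of_nonneg)

lemma vabs_eq_0_iff [simp]: "vabs x = 0 \<longleftrightarrow> x = 0"
  for x :: "'a::{ordered_real_vector, lattice}"
proof
  assume "vabs x = 0"
  then have "x \<le> 0" "- x \<le> 0"
    by (metis le_vabs, metis neg_le_vabs)
  then show "x = 0"
    by (intro antisym) simp_all
qed simp

lemma vabs_minus_commute: "vabs (x - y) = vabs (y - x)"
  for x y :: "'a::{ordered_real_vector, lattice}"
  using vabs_minus[of "x - y"] by simp

lemma vabs_triangle: "vabs (x + y) \<le> vabs x + vabs y"
  for x y :: "'a::{ordered_real_vector, lattice}"
proof (rule vabs_leI)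
  show "- (x + y) \<le> vabs x + vabs y"
    using add_mono[OF neg_le_vabs[of x] neg_le_vabs[of y]] by (simp add: algebra_simps)
qed (simp add: add_mono le_vabs)

lemma vabs_triangle_diff: "vabs (x - y) \<le> vabs x + vabs y"
  for x y :: "'a::{ordered_real_vector, lattice}"
  using vabs_triangle[of x "- y"] by simp

lemma vabs_le_add_diff: "vabs x \<le> vabs y + vabs (x - y)"
  for x y :: "'a::{ordered_real_vector, lattice}"
  using vabs_triangle[of y "x - y"] by simp

lemma vabs_diff_le:
  "vabs x - vabs y \<le> vabs (x + y)"
  for x y :: "'a::{ordered_real_vector, lattice}"
  using vabs_triangle[of "x + y" "- y"] by (simp add: algebra_simps)

lemma vabs_scaleR: "vabs (c *\<^sub>R x) = \<bar>c\<bar> *\<^sub>R vabs x"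
  for x :: "'a::{ordered_real_vector, lattice}"
proof -
  have le: "vabs (c *\<^sub>R x) \<le> c *\<^sub>R vabs x" if "0 \<le> c" for c and x :: 'a
    using that scaleR_left_mono[OF le_vabs[of x], of c] scaleR_left_mono[OF neg_le_vabs[of x], of c]
    by (intro vabs_leI) simp_all
  have eq: "vabs (c *\<^sub>R x) = c *\<^sub>R vabs x" if "0 < c" for c and x :: 'a
  proof (rule antisym)
    have "vabs x \<le> inverse c *\<^sub>R vabs (c *\<^sub>R x)"
      using le[of "inverse c" "c *\<^sub>R x"] that by simp
    then have "c *\<^sub>R vabs x \<le> c *\<^sub>R (inverse c *\<^sub>R vabs (c *\<^sub>R x))"
      using that by (intro scaleR_left_mono) auto
    then show "c *\<^sub>R vabs x \<le> vabs (c *\<^sub>R x)"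
      using that by simp
  qed (use le that in simp)
  show ?thesis
    using eq[of c x] eq[of "- c" x] by (cases c "0::real" rule: linorder_cases) simp_all
qed

lemma pos_plus_neg: "sup x 0 + sup (- x) 0 = vabs x"
  for x :: "'a::{ordered_real_vector, lattice}"
proof -
  have "sup x 0 + sup (- x) 0 = sup (x + sup (- x) 0) (0 + sup (- x) 0)"
    by (rule sup_add_right)
  also have "x + sup (- x) 0 = sup x 0"
    using pos_minus_neg[of x] by (simp add: algebra_simps)
  also have "sup (sup x 0) (0 + sup (- x) 0) = sup (vabs x) 0"
    by (simp add: vabs_def ac_simps)
  finally show ?thesis
    by (simp add: sup_absorb1)
qed

lemma pos_add_le: "sup (x + y) 0 \<le> sup x 0 + sup y 0"
  for x y :: "'a::{ordered_real_vector, lattice}"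
proof (rule le_supI)
  show "x + y \<le> sup x 0 + sup y 0"
    by (rule add_mono) simp_all
qed (simp add: add_nonneg_nonneg)

lemma vabs_pos_le: "vabs (sup x 0) \<le> vabs x"
  for x :: "'a::{ordered_real_vector, lattice}"
  by (simp add: vabs_of_nonneg le_vabs)

lemma vabs_neg_le: "vabs (sup (- x) 0) \<le> vabs x"
  for x :: "'a::{ordered_real_vector, lattice}"
  using vabs_pos_le[of "- x"] by simp

lemma inf_pos_neg: "inf (sup x 0) (sup (- x) 0) = 0"
  for x :: "'a::{ordered_real_vector, lattice}"
proof -
  have "sup (sup x 0) (sup (- x) 0) = sup (vabs x) 0"
    by (simp add: vabs_def ac_simps)
  then show ?thesis
    using sup_plus_inf[of "sup x 0" "sup (- x) 0"] by (simp add: pos_plus_neg sup_absorb1)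
qed

text \<open>Both parts of \<open>x\<close> are truncated at \<open>y\<close>. What truncation
  removes from \<open>u\<close> is the positive part of \<open>u - y\<close>, hence at most
  \<open>z\<close>. A difference of two elements of \<open>[0, w]\<close> has absolute value at most
  \<open>w\<close>, which recombines the parts without losing a factor 2.\<close>

lemma riesz_decomposition:
  fixes x y z :: "'a::{ordered_real_vector, lattice}"
  assumes "vabs x \<le> y + z" "0 \<le> y" "0 \<le> z"
  obtains p q where "x = p + q" "vabs p \<le> y" "vabs q \<le> z" "vabs p \<le> vabs x" "vabs q \<le> vabs x"
proof -
  define p1 p2 where "p1 = inf (sup x 0) y" and "p2 = inf (sup (- x) 0) y"
  define q1 q2 where "q1 = sup x 0 - p1" and "q2 = sup (- x) 0 - p2"
  have le: "sup x 0 \<le> vabs x" "sup (- x) 0 \<le> vabs x"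
    by (simp_all add: le_vabs neg_le_vabs)
  have p: "0 \<le> p1" "0 \<le> p2" "p1 \<le> sup x 0" "p2 \<le> sup (- x) 0" "p1 \<le> y" "p2 \<le> y"
    using assms by (simp_all add: p1_def p2_def)
  have q: "0 \<le> q1" "0 \<le> q2" "q1 \<le> sup x 0" "q2 \<le> sup (- x) 0"
    using p by (simp_all add: q1_def q2_def)
  have r: "u - inf u y \<le> z" if "u \<le> vabs x" for u
  proof -
    have "u - inf u y = sup (- u) (- y) + u"
      by (simp flip: neg_inf_eq)
    also have "\<dots> = sup 0 (u - y)"
      by (simp add: sup_add_right)
    also have "\<dots> \<le> z"
      using assms(3) order_trans[OF that assms(1)] by (intro le_supI) (simp_all add: diff_le_eq add.commute)
    finally show ?thesis .
  qed
  have qz: "q1 \<le> z" "q2 \<le> z"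
    using r[OF le(1)] r[OF le(2)] by (simp_all add: q1_def q2_def p1_def p2_def)
  have bound: "vabs (u - v) \<le> w" if "0 \<le> u" "0 \<le> v" "u \<le> w" "v \<le> w" for u v w :: 'a
    using diff_mono[OF that(3,2)] diff_mono[OF that(4,1)] by (intro vabs_leI) simp_all
  show ?thesis
  proof
    show "x = (p1 - p2) + (q1 - q2)"
      using pos_minus_neg[of x] by (simp add: q1_def q2_def algebra_simps)
    show "vabs (p1 - p2) \<le> y" "vabs (q1 - q2) \<le> z"
      by (rule bound; fact p q qz)+
    show "vabs (p1 - p2) \<le> vabs x" "vabs (q1 - q2) \<le> vabs x"
      using p q le by (blast intro: bound order_trans)+
  qed
qed

section \<open>Disjointness\<close>

lemma vdisj_commute: "vdisj x y \<longleftrightarrow> vdisj y x"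
  by (simp add: vdisj_def inf_commute)

lemma vdisj_sym: "vdisj x y \<Longrightarrow> vdisj y x"
  by (simp add: vdisj_commute)

lemma vdisj_iff_le: "vdisj x y \<longleftrightarrow> inf (vabs x) (vabs y) \<le> 0"
  unfolding vdisj_def by (auto intro: antisym)

lemma vdisj_mono: "vdisj x y \<Longrightarrow> vabs x' \<le> vabs x \<Longrightarrow> vdisj x' y"
  unfolding vdisj_iff_le by (rule order_trans[OF inf_mono[OF _ order_refl]])

lemma vdisj_zero [simp]: "vdisj 0 x" "vdisj x 0"
  by (simp_all add: vdisj_def inf_absorb1[OF vabs_nonneg] inf_absorb2[OF vabs_nonneg])

lemma vdisj_self [simp]: "vdisj x x \<longleftrightarrow> x = 0"
  by (simp add: vdisj_def)

lemma vdisj_minus [simp]: "vdisj (- x) y \<longleftrightarrow> vdisj x y" "vdisj x (- y) \<longleftrightarrow> vdisj x y"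
  by (simp_all add: vdisj_def)

lemma vdisj_vabs [simp]: "vdisj (vabs x) y \<longleftrightarrow> vdisj x y" "vdisj x (vabs y) \<longleftrightarrow> vdisj x y"
  by (simp_all add: vdisj_def)

lemma vdisj_le_add:
  assumes "vdisj x z" "vdisj y z" "vabs w \<le> vabs x + vabs y"
  shows "vdisj w z"
proof -
  have "inf (vabs w) (vabs z) \<le> inf (vabs z) (vabs x + vabs y)"
    by (rule le_infI[OF inf_le2 order_trans[OF inf_le1 assms(3)]])
  also have "\<dots> \<le> inf (vabs z) (vabs x) + inf (vabs z) (vabs y)"
    by (rule inf_add_le) simp_all
  also have "\<dots> = 0"
    using assms(1,2) by (simp add: vdisj_def inf_commute)
  finally show ?thesis
    by (simp only: vdisj_iff_le)
qed

lemma vdisj_add: "vdisj x z \<Longrightarrow> vdisj y z \<Longrightarrow> vdisj (x + y) z"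
  by (erule (1) vdisj_le_add) (rule vabs_triangle)

lemma vdisj_diff: "vdisj x z \<Longrightarrow> vdisj y z \<Longrightarrow> vdisj (x - y) z"
  using vdisj_add[of x z "- y"] by simp

lemma vdisj_scaleR: "vdisj x z \<Longrightarrow> vdisj (c *\<^sub>R x) z"
proof -
  assume x: "vdisj x z"
  have "vdisj (real n *\<^sub>R x) z" for n
    by (induction n) (use x in \<open>auto simp: scaleR_add_left intro: vdisj_add\<close>)
  moreover obtain n where "\<bar>c\<bar> \<le> real n"
    using real_arch_simple by blast
  then have "vabs (c *\<^sub>R x) \<le> vabs (real n *\<^sub>R x)"
    by (simp add: vabs_scaleR scaleR_right_mono)
  ultimately show ?thesis
    using vdisj_mono by blast
qed

lemma vdisj_add_right: "vdisj z x \<Longrightarrow> vdisj z y \<Longrightarrow> vdisj z (x + y)"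
  using vdisj_add[of x z y] by (simp add: vdisj_commute)

lemma vdisj_diff_right: "vdisj z x \<Longrightarrow> vdisj z y \<Longrightarrow> vdisj z (x - y)"
  using vdisj_diff[of x z y] by (simp add: vdisj_commute)

lemma vdisj_scaleR_right: "vdisj z x \<Longrightarrow> vdisj z (c *\<^sub>R x)"
  using vdisj_scaleR[of x z c] by (simp add: vdisj_commute)

lemma vdisj_le_scaleR: "vdisj y z \<Longrightarrow> vabs x \<le> c *\<^sub>R vabs y \<Longrightarrow> vdisj x z"
  by (rule vdisj_mono[of "c *\<^sub>R vabs y"]) (simp add: vdisj_scaleR, rule order_trans[OF _ le_vabs])

lemma vdisj_sum: "(\<And>i. i \<in> I \<Longrightarrow> vdisj (f i) z) \<Longrightarrow> vdisj (sum f I) z"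
  by (induction I rule: infinite_finite_induct) (auto intro: vdisj_add)

lemma vdisj_pos_neg: "vdisj (sup x 0) (sup (- x) 0)"
  by (simp add: vdisj_def vabs_of_nonneg inf_pos_neg)

lemma vabs_add_disjoint:
  assumes "vdisj x y"
  shows "vabs (x + y) = vabs x + vabs y"
proof (rule antisym[OF vabs_triangle])
  define t where "t = sup (- vabs x) (- vabs y)"
  have "- vabs x \<le> vabs (x + y) - vabs x" "- vabs y \<le> vabs (x + y) - vabs x"
    "- vabs x \<le> vabs (x + y) - vabs y" "- vabs y \<le> vabs (x + y) - vabs y"
    using vabs_diff_le[of x y] vabs_diff_le[of y x] by (simp_all add: algebra_simps)
  then have "t \<le> vabs (x + y) - vabs x" "t \<le> vabs (x + y) - vabs y"
    by (simp_all only: t_def le_sup_iff)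
  \<comment> \<open>Since \<open>- t\<close> is the infimum of \<open>vabs x\<close> and
    \<open>vabs y\<close>, this bound holds for arbitrary elements. Disjointness then makes the
    infimum 0 and the supremum equal to the sum.\<close>
  then have "sup (vabs x) (vabs y) \<le> vabs (x + y) - t"
    by (intro le_supI) (simp_all only: le_diff_eq add.commute)
  moreover have "t = - inf (vabs x) (vabs y)"
    by (simp add: t_def neg_inf_eq)
  ultimately show "vabs x + vabs y \<le> vabs (x + y)"
    using sup_plus_inf[of "vabs x" "vabs y"] assms unfolding vdisj_def
    by (simp only: add_0_right diff_0_right minus_zero)
qed

lemma vabs_diff_disjoint: "vdisj x y \<Longrightarrow> vabs (x - y) = vabs x + vabs y"
  using vabs_add_disjoint[of x "- y"] by simp

text \<open>Absolute values add on disjoint elements, so \<open>vabs x - x\<close> and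
  \<open>vabs y - y\<close> are nonnegative with sum 0. Later this reads inequalities between images
  off a regrouped sum with disjoint halves.\<close>

lemma vdisj_nonneg_addD:
  assumes "vdisj x y" "0 \<le> x + y"
  shows "0 \<le> x"
proof -
  have "(vabs x - x) + (vabs y - y) = 0"
    using vabs_add_disjoint[OF assms(1)] vabs_of_nonneg[OF assms(2)] by (simp add: algebra_simps)
  moreover have "0 \<le> vabs x - x" "0 \<le> vabs y - y"
    by (simp_all add: le_vabs)
  ultimately have "vabs x - x = 0"
    by (simp add: add_nonneg_eq_0_iff)
  then show ?thesis
    by (metis eq_iff_diff_eq_0 vabs_nonneg)
qed

text \<open>An element lies in its own band. This trades inclusion of double complements for the
  reversed inclusion of single complements, the form in which condition (beta) is used
  throughout.\<close>

lemma band_le_iff: "band_le a b \<longleftrightarrow> (\<forall>z. vdisj z b \<longrightarrow> vdisj z a)"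
proof
  assume "band_le a b"
  moreover have "a \<in> dcompl (dcompl {a})"
    by (auto simp: dcompl_def vdisj_commute)
  ultimately have "a \<in> dcompl (dcompl {b})"
    by (auto simp: band_le_def)
  then show "\<forall>z. vdisj z b \<longrightarrow> vdisj z a"
    by (auto simp: dcompl_def vdisj_commute)
qed (auto simp: band_le_def dcompl_def)

lemma band_leI_le: "vabs x \<le> c *\<^sub>R vabs y \<Longrightarrow> band_le x y"
  unfolding band_le_iff by (blast intro: vdisj_sym vdisj_le_scaleR)

lemma band_leD: "band_le a b \<Longrightarrow> vdisj b z \<Longrightarrow> vdisj a z"
  unfolding band_le_iff by (blast intro: vdisj_sym)

text \<open>Passing to positive parts and taking \<open>e = 1 / n\<close> gives the multiples
  required by the definition. Here \<open>u\<close> may have any sign.\<close>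

lemma archimedean_le_0:
  fixes x u :: "'a::{ordered_real_vector, lattice}"
  assumes "archimedean_vl TYPE('a)" and le: "\<And>e. 0 < e \<Longrightarrow> x \<le> e *\<^sub>R u"
  shows "x \<le> 0"
proof -
  have "real n *\<^sub>R sup x 0 \<le> sup u 0" for n
  proof (cases "n = 0")
    case False
    have "x \<le> (1 / real n) *\<^sub>R u"
      using False le by simp
    also have "\<dots> \<le> (1 / real n) *\<^sub>R sup u 0"
      by (intro scaleR_left_mono) simp_all
    finally have "sup x 0 \<le> (1 / real n) *\<^sub>R sup u 0"
      by (simp add: scaleR_nonneg_nonneg)
    from scaleR_left_mono[OF this, of "real n"] show ?thesis
      using False by simp
  qed simp
  then have "sup x 0 = 0"
    using assms(1) unfolding archimedean_vl_def by (metis sup_ge2)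
  then show ?thesis
    by (metis sup_ge1)
qed

lemma inf_vabs_add_le: "inf (vabs x) (vabs z) \<le> inf (vabs y) (vabs z) + vabs (x - y)"
proof -
  have "inf (vabs x) (vabs z) \<le> inf (vabs z) (vabs y + vabs (x - y))"
    by (rule le_infI[OF inf_le2 order_trans[OF inf_le1 vabs_le_add_diff]])
  also have "\<dots> \<le> inf (vabs z) (vabs y) + inf (vabs z) (vabs (x - y))"
    by (rule inf_add_le) simp_all
  also have "\<dots> \<le> inf (vabs y) (vabs z) + vabs (x - y)"
    by (simp add: inf_commute)
  finally show ?thesis .
qed

text \<open>The map sending \<open>x\<close> to \<open>inf (vabs x) (vabs z)\<close> changes by at
  most \<open>vabs (x - y)\<close>, so disjoint complements are closed under relatively uniform
  limits.\<close>

lemma vdisj_approx: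
  fixes g z u :: "'a::{ordered_real_vector, lattice}"
  assumes "archimedean_vl TYPE('a)"
    and approx: "\<And>e. 0 < e \<Longrightarrow> \<exists>h. vdisj h z \<and> vabs (g - h) \<le> e *\<^sub>R u"
  shows "vdisj g z"
  unfolding vdisj_iff_le
proof (rule archimedean_le_0[OF assms(1)])
  fix e :: real assume "0 < e"
  then obtain h where h: "vdisj h z" "vabs (g - h) \<le> e *\<^sub>R u"
    using approx by blast
  have "inf (vabs g) (vabs z) \<le> inf (vabs h) (vabs z) + vabs (g - h)"
    by (rule inf_vabs_add_le)
  also have "\<dots> = vabs (g - h)"
    using h(1) by (simp add: vdisj_def)
  finally show "inf (vabs g) (vabs z) \<le> e *\<^sub>R u"
    using h(2) by (rule order_trans)
qed

section \<open>Lattice norms and relatively uniform convergence\<close>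

context
  fixes N :: "'a::{ordered_real_vector, lattice} \<Rightarrow> real"
  assumes N: "lattice_norm N"
begin

lemma lattice_norm_eq_0: "N x = 0 \<longleftrightarrow> x = 0"
  using N unfolding lattice_norm_def by blast

lemma lattice_norm_triangle: "N (x + y) \<le> N x + N y"
  using N unfolding lattice_norm_def by blast

lemma lattice_norm_scaleR: "N (c *\<^sub>R x) = \<bar>c\<bar> * N x"
  using N unfolding lattice_norm_def by blast

lemma lattice_norm_mono: "vabs x \<le> vabs y \<Longrightarrow> N x \<le> N y"
  using N unfolding lattice_norm_def by blast

lemma lattice_norm_nonneg: "0 \<le> N x"
  using lattice_norm_mono[of 0 x] by (simp add: lattice_norm_eq_0[of 0, simplified])

lemma lattice_norm_minus: "N (- x) = N x"
  by (intro antisym lattice_norm_mono) simp_all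

lemma lattice_norm_triangle_diff: "N (x - y) \<le> N x + N y"
  using lattice_norm_triangle[of x "- y"] by (simp add: lattice_norm_minus)

lemma lattice_norm_le_0_imp: "N x \<le> 0 \<Longrightarrow> x = 0"
  using lattice_norm_nonneg[of x] by (simp flip: lattice_norm_eq_0)

end

lemma half_power_small:
  fixes e C :: real
  assumes "0 < e"
  obtains n where "n0 \<le> n" "C * (1/2) ^ n < e"
proof -
  obtain n where n: "(1/2 :: real) ^ n < e / (\<bar>C\<bar> + 1)"
    using real_arch_pow_inv[of "e / (\<bar>C\<bar> + 1)" "1/2"] assms by auto
  have "C * (1/2) ^ max n n0 \<le> (\<bar>C\<bar> + 1) * (1/2) ^ n"
    by (intro mult_mono power_decreasing) auto
  also have "\<dots> < e"
    using n by (simp add: field_simps)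
  finally show ?thesis
    by (intro that[of "max n n0"]) simp_all
qed

lemma geometric_partial_sums:
  fixes f :: "nat \<Rightarrow> 'a::{ordered_real_vector, lattice}"
  assumes le: "\<And>k. vabs (f k) \<le> e" and "n \<le> m"
  shows "vabs ((\<Sum>k<m. (1/2) ^ k *\<^sub>R f k) - (\<Sum>k<n. (1/2) ^ k *\<^sub>R f k)) \<le> (2 * (1/2) ^ n) *\<^sub>R e"
proof -
  have e: "0 \<le> e"
    using order_trans[OF vabs_nonneg le] .
  \<comment> \<open>The sharper bound with \<open>m\<close> subtracted is what the induction can
    carry: it grows by exactly one term of the geometric series.\<close>
  have "vabs ((\<Sum>k<m. (1/2) ^ k *\<^sub>R f k) - (\<Sum>k<n. (1/2) ^ k *\<^sub>R f k))
    \<le> (2 * (1/2) ^ n - 2 * (1/2) ^ m) *\<^sub>R e"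
    using \<open>n \<le> m\<close>
  proof (induction m rule: dec_induct)
    case (step m)
    have "vabs ((\<Sum>k<Suc m. (1/2) ^ k *\<^sub>R f k) - (\<Sum>k<n. (1/2) ^ k *\<^sub>R f k))
      = vabs (((\<Sum>k<m. (1/2) ^ k *\<^sub>R f k) - (\<Sum>k<n. (1/2) ^ k *\<^sub>R f k)) + (1/2) ^ m *\<^sub>R f m)"
      by (simp add: algebra_simps)
    also have "\<dots> \<le> (2 * (1/2) ^ n - 2 * (1/2) ^ m) *\<^sub>R e + (1/2) ^ m *\<^sub>R e"
      using step.IH le[of m] by (intro order_trans[OF vabs_triangle] add_mono) (simp_all add: vabs_scaleR scaleR_left_mono)
    also have "\<dots> = (2 * (1/2) ^ n - 2 * (1/2) ^ Suc m) *\<^sub>R e"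
      by (simp flip: scaleR_add_left)
    finally show ?case .
  qed simp
  also have "\<dots> \<le> (2 * (1/2) ^ n) *\<^sub>R e"
    using e by (intro scaleR_right_mono) simp_all
  finally show ?thesis .
qed

lemma ru_complete_geometric:
  fixes f :: "nat \<Rightarrow> 'a::{ordered_real_vector, lattice}"
  assumes arch: "archimedean_vl TYPE('a)" and ru: "ru_complete TYPE('a)"
    and le: "\<And>k. vabs (f k) \<le> e"
  obtains l where "\<And>n. vabs (l - (\<Sum>k<n. (1/2) ^ k *\<^sub>R f k)) \<le> (2 * (1/2) ^ n) *\<^sub>R e"
proof -
  define s where "s n = (\<Sum>k<n. (1/2) ^ k *\<^sub>R f k)" for n
  have e: "0 \<le> e"
    using order_trans[OF vabs_nonneg le] .
  have s: "vabs (s m - s n) \<le> (2 * (1/2) ^ n) *\<^sub>R e" if "n \<le> m" for m n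
    unfolding s_def using geometric_partial_sums[OF le that] .
  have "ru_cauchy s"
    unfolding ru_cauchy_def
  proof (intro exI[of _ e] conjI allI impI)
    fix d :: real assume "0 < d"
    then obtain K where K: "2 * (1/2) ^ K < d"
      by (rule half_power_small)
    have "vabs (s m - s n) \<le> d *\<^sub>R e" if "K \<le> n" "n \<le> m" for m n
    proof -
      have "2 * (1/2 :: real) ^ n \<le> 2 * (1/2) ^ K"
        using that by (intro mult_left_mono power_decreasing) simp_all
      then have "2 * (1/2) ^ n \<le> d"
        using K by linarith
      then have "(2 * (1/2) ^ n) *\<^sub>R e \<le> d *\<^sub>R e"
        using e by (rule scaleR_right_mono)
      with s[OF that(2)] show ?thesis
        by (rule order_trans)
    qed
    then have "vabs (s m - s n) \<le> d *\<^sub>R e" if "K \<le> n" "K \<le> m" for m n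
      using that by (metis nle_le vabs_minus_commute)
    then show "\<exists>K. \<forall>m\<ge>K. \<forall>n\<ge>K. vabs (s m - s n) \<le> d *\<^sub>R e"
      by blast
  qed fact
  then obtain l where "ru_converges s l"
    using ru unfolding ru_complete_def by blast
  then obtain u where u: "\<And>d. 0 < d \<Longrightarrow> \<exists>K. \<forall>n\<ge>K. vabs (s n - l) \<le> d *\<^sub>R u"
    unfolding ru_converges_def by blast
  \<comment> \<open>Completeness supplies a limit whose regulator \<open>u\<close> is unrelated to
    \<open>e\<close>. Comparing with late partial sums and using the Archimedean property eliminates
    \<open>u\<close> and leaves the geometric tail.\<close>
  have "vabs (l - s n) - (2 * (1/2) ^ n) *\<^sub>R e \<le> 0" for n
  proof (rule archimedean_le_0[OF arch])
    fix d :: real assume "0 < d"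
    then obtain K where K: "\<forall>n\<ge>K. vabs (s n - l) \<le> d *\<^sub>R u"
      using u by blast
    have "vabs (l - s n) = vabs ((l - s (max K n)) + (s (max K n) - s n))"
      by simp
    also have "\<dots> \<le> vabs (l - s (max K n)) + vabs (s (max K n) - s n)"
      by (rule vabs_triangle)
    also have "\<dots> \<le> d *\<^sub>R u + (2 * (1/2) ^ n) *\<^sub>R e"
      using K s by (intro add_mono) (simp_all add: vabs_minus_commute[of l])
    finally show "vabs (l - s n) - (2 * (1/2) ^ n) *\<^sub>R e \<le> d *\<^sub>R u"
      by (simp only: diff_le_eq)
  qed
  then show ?thesis
    unfolding s_def diff_le_0_iff_le by (rule that)
qed

text \<open>Let \<open>l\<close> be the sum of the \<open>f k\<close> with weights
  \<open>(1/2) ^ k\<close>. Removing the \<open>n\<close>-th term leaves \<open>g\<close> in the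
  band generated by the other humps, so by \<open>disj\<close> the hump survives in
  \<open>T l\<close>, whose norm would be at least \<open>4 ^ n / 2 ^ n\<close> for every
  \<open>n\<close>. The abstract form of \<open>disj\<close> serves both operators that preserve
  disjointness and operators with condition (beta).\<close>

lemma gliding_hump:
  fixes T :: "'a::{ordered_real_vector, lattice} \<Rightarrow> 'b::{ordered_real_vector, lattice}"
  assumes arch: "archimedean_vl TYPE('a)" and ru: "ru_complete TYPE('a)"
    and N: "lattice_norm N" and lin: "linear T"
    and le: "\<And>n. vabs (f n) \<le> e"
    and disj: "\<And>n g. (\<And>z. (\<And>k. k \<noteq> n \<Longrightarrow> vdisj (f k) z) \<Longrightarrow> vdisj g z) \<Longrightarrow> vdisj (T g) (T (f n))"
  shows "\<exists>n. N (T (f n)) < 4 ^ n"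
proof (rule ccontr)
  assume "\<not> ?thesis"
  then have large: "4 ^ n \<le> N (T (f n))" for n
    by (auto simp: not_less)
  obtain l where l: "\<And>n. vabs (l - (\<Sum>k<n. (1/2) ^ k *\<^sub>R f k)) \<le> (2 * (1/2) ^ n) *\<^sub>R e"
    by (rule ru_complete_geometric[OF arch ru, of f e, OF le]) (blast intro: that)
  have e: "0 \<le> e"
    using order_trans[OF vabs_nonneg le] .
  have "2 ^ n \<le> N (T l)" for n
  proof -
    define g where "g = l - (1/2) ^ n *\<^sub>R f n"
    have "vdisj (T g) (T (f n))"
    proof (rule disj)
      fix z assume z: "\<And>k. k \<noteq> n \<Longrightarrow> vdisj (f k) z"
      show "vdisj g z"
      proof (rule vdisj_approx[OF arch])
        fix d :: real assume "0 < d"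
        then obtain m where m: "Suc n \<le> m" "2 * (1/2) ^ m < d"
          by (rule half_power_small)
        define h where "h = (\<Sum>k\<in>{..<m} - {n}. (1/2) ^ k *\<^sub>R f k)"
        have "g - h = l - (\<Sum>k<m. (1/2) ^ k *\<^sub>R f k)"
          using m(1) sum.remove[of "{..<m}" n "\<lambda>k. (1/2) ^ k *\<^sub>R f k"] by (simp add: g_def h_def)
        moreover have "(2 * (1/2) ^ m) *\<^sub>R e \<le> d *\<^sub>R e"
          using m e by (intro scaleR_right_mono) simp_all
        ultimately have "vabs (g - h) \<le> d *\<^sub>R e"
          using l[of m] by (metis order_trans)
        moreover have "vdisj h z"
          unfolding h_def using z by (intro vdisj_sum vdisj_scaleR) simp
        ultimately show "\<exists>h. vdisj h z \<and> vabs (g - h) \<le> d *\<^sub>R e"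
          by blast
      qed
    qed
    then have "vdisj ((1/2) ^ n *\<^sub>R T (f n)) (T g)"
      by (rule vdisj_scaleR[OF vdisj_sym])
    then have "vabs ((1/2) ^ n *\<^sub>R T (f n) + T g) = vabs ((1/2) ^ n *\<^sub>R T (f n)) + vabs (T g)"
      by (rule vabs_add_disjoint)
    moreover have "(1/2) ^ n *\<^sub>R T (f n) + T g = T l"
      by (simp add: g_def linear_diff[OF lin] linear_scale[OF lin])
    ultimately have "vabs ((1/2) ^ n *\<^sub>R T (f n)) \<le> vabs (T l)"
      by simp
    then have "N ((1/2) ^ n *\<^sub>R T (f n)) \<le> N (T l)"
      by (rule lattice_norm_mono[OF N])
    then have "(1/2) ^ n * N (T (f n)) \<le> N (T l)"
      by (simp add: lattice_norm_scaleR[OF N])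
    moreover have "(1/2) ^ n * 4 ^ n \<le> (1/2) ^ n * N (T (f n))"
      using large by (intro mult_left_mono) simp_all
    moreover have "(1/2 :: real) ^ n * 4 ^ n = 2 ^ n"
      by (simp flip: power_mult_distrib)
    ultimately show ?thesis
      by linarith
  qed
  moreover obtain n where "N (T l) < 2 ^ n"
    using real_arch_pow[of 2 "N (T l)"] by auto
  ultimately show False
    using not_less by blast
qed

section \<open>Inverses and condition (beta)\<close>

lemma condition_beta_reflects_disjoint:
  fixes T :: "'a::{ordered_real_vector, lattice} \<Rightarrow> 'b::{ordered_real_vector, lattice}"
  assumes lin: "linear T" and inj: "inj T" and beta: "condition_beta T"
    and disj: "vdisj (T a) (T b)"
  shows "vdisj a b"
proof -
  define h where "h = inf (vabs a) (vabs b)"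
  have "0 \<le> h"
    by (simp add: h_def)
  then have "band_le h a" "band_le h b"
    using band_leI_le[of h 1 a] band_leI_le[of h 1 b] by (simp_all add: h_def vabs_of_nonneg)
  then have "band_le (T h) (T a)" "band_le (T h) (T b)"
    using beta by (simp_all add: condition_beta_def)
  then have "vdisj (T h) (T h)"
    using disj by (meson band_leD vdisj_commute)
  then have "h = 0"
    using inj linear_0[OF lin] by (metis injD vdisj_self)
  then show ?thesis
    by (simp add: vdisj_def h_def)
qed

text \<open>By surjectivity an element disjoint from \<open>T b\<close> has the form
  \<open>T c\<close>. Disjointness is pulled back to \<open>c\<close> and \<open>b\<close>, passed
  on to \<open>c\<close> and \<open>a\<close>, and pushed forward again.\<close>

lemma disjointness_preserving_imp_condition_beta:
  assumes dp: "disjointness_preserving T" and surj: "surj T"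
    and refl: "\<And>a b. vdisj (T a) (T b) \<Longrightarrow> vdisj a b"
  shows "condition_beta T"
  unfolding condition_beta_def band_le_iff
proof (intro allI impI)
  fix a b z assume *: "\<forall>z. vdisj z b \<longrightarrow> vdisj z a" "vdisj z (T b)"
  obtain c where "z = T c"
    using surj by (metis surjD)
  then show "vdisj z (T a)"
    using * refl dp by (metis disjointness_preserving_def)
qed

text \<open>The projection of \<open>x\<close> onto the band of \<open>w\<close> is the supremum of
  the countably many truncations of \<open>x\<close> at multiples of \<open>vabs w\<close>.\<close>

lemma sigma_complete_projection:
  fixes x w :: "'a::{ordered_real_vector, lattice}"
  assumes sc: "dedekind_sigma_complete TYPE('a)" and x: "0 \<le> x"
  obtains p where "0 \<le> p" "p \<le> x" "vdisj (x - p) w" "\<And>z. vdisj w z \<Longrightarrow> vdisj p z"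
proof -
  define q where "q n = inf x (real n *\<^sub>R vabs w)" for n
  have q: "0 \<le> q n" "q n \<le> x" for n
    using x by (simp_all add: q_def scaleR_nonneg_nonneg)
  then have "countable (range q) \<and> range q \<noteq> {} \<and> (\<exists>u. \<forall>a\<in>range q. a \<le> u)"
    by auto
  then have "\<exists>p. (\<forall>a\<in>range q. a \<le> p) \<and> (\<forall>u. (\<forall>a\<in>range q. a \<le> u) \<longrightarrow> p \<le> u)"
    by (rule sc[unfolded dedekind_sigma_complete_def, THEN spec, THEN mp])
  then obtain p where p: "\<forall>a\<in>range q. a \<le> p" "\<And>u. \<forall>a\<in>range q. a \<le> u \<Longrightarrow> p \<le> u"
    by blast
  have ub: "q n \<le> p" for n
    using p(1) by simp
  have lub: "p \<le> u" if "\<And>n. q n \<le> u" for u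
    using p(2)[of u] that by blast
  have p0: "0 \<le> p"
    using q ub order_trans by blast
  have px: "p \<le> x"
    using q lub by blast
  have "vdisj (x - p) w"
  proof -
    define h where "h = inf (x - p) (vabs w)"
    \<comment> \<open>Adding \<open>h\<close> moves from the truncation \<open>q n\<close> to at
      most the next one, so the supremum absorbs \<open>h\<close>.\<close>
    have "h + q n \<le> p" for n
    proof -
      have "h \<le> x - p" "h \<le> vabs w"
        by (simp_all add: h_def)
      have "h + q n \<le> x - p + p"
        using \<open>h \<le> x - p\<close> ub by (rule add_mono)
      moreover have "h + q n \<le> vabs w + real n *\<^sub>R vabs w"
        using \<open>h \<le> vabs w\<close> by (rule add_mono) (simp add: q_def)
      ultimately have "h + q n \<le> q (Suc n)"
        by (simp add: q_def scaleR_add_left)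
      then show ?thesis
        using ub order_trans by blast
    qed
    then have "p \<le> p - h"
      by (intro lub) (simp add: le_diff_eq add.commute)
    then have "h \<le> 0"
      by (simp add: le_diff_eq)
    then show ?thesis
      using px by (simp add: vdisj_iff_le h_def vabs_of_nonneg)
  qed
  moreover have "vdisj p z" if z: "vdisj w z" for z
  proof -
    define k where "k = inf p (vabs z)"
    have k0: "0 \<le> k"
      using p0 by (simp add: k_def)
    \<comment> \<open>Each \<open>q n\<close> is a truncation at a multiple of
      \<open>vabs w\<close>, hence disjoint from \<open>z\<close> and from \<open>k\<close>. The sum
      is therefore a supremum and stays below \<open>p\<close>.\<close>
    have "k + q n \<le> p" for n
    proof -
      have "vabs (q n) \<le> real n *\<^sub>R vabs w"
        using q by (simp add: vabs_of_nonneg) (simp add: q_def)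
      then have "vdisj (q n) z"
        using z vdisj_le_scaleR by blast
      then have "inf k (q n) \<le> 0"
        using q p0 le_infI1 unfolding vdisj_iff_le k_def
        by (simp add: vabs_of_nonneg inf_commute inf_left_commute order_trans[OF inf_le2])
      moreover have "0 \<le> inf k (q n)"
        using k0 q by simp
      ultimately have "k + q n = sup k (q n)"
        using sup_plus_inf[of k "q n"] by (metis add.right_neutral antisym)
      also have "\<dots> \<le> p"
        using ub by (simp add: k_def)
      finally show ?thesis .
    qed
    then have "p \<le> p - k"
      by (intro lub) (simp add: le_diff_eq add.commute)
    then have "k \<le> 0"
      by (simp add: le_diff_eq)
    then show ?thesis
      using p0 by (simp add: vdisj_iff_le k_def vabs_of_nonneg)
  qed
  ultimately show ?thesis
    using that p0 px by blast
qed

text \<open>Split \<open>x1\<close> into \<open>p\<close> in the band of \<open>x2\<close> and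
  \<open>q\<close> disjoint from \<open>x2\<close>. Then \<open>T q\<close> is disjoint from
  \<open>T p\<close>, and also from \<open>T x1\<close> because of \<open>band\<close>. Being their
  difference, it is disjoint from itself, so \<open>q = 0\<close>.\<close>

lemma sigma_complete_inverse_beta:
  fixes T :: "'a::{ordered_real_vector, lattice} \<Rightarrow> 'b::{ordered_real_vector, lattice}"
  assumes sc: "dedekind_sigma_complete TYPE('a)"
    and lin: "linear T" and bij: "bij T" and dp: "disjointness_preserving T"
  shows "condition_beta (inv T)"
proof -
  have dpD: "vdisj (T x) (T y)" if "vdisj x y" for x y
    using dp that by (simp add: disjointness_preserving_def)
  have "band_le x1 x2" if band: "band_le (T x1) (T x2)" for x1 x2
  proof -
    obtain p1 where p1: "0 \<le> p1" "p1 \<le> sup x1 0" "vdisj (sup x1 0 - p1) x2" "\<And>z. vdisj x2 z \<Longrightarrow> vdisj p1 z"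
      by (rule sigma_complete_projection[OF sc, of "sup x1 0" x2], simp) (blast intro: that)
    obtain p2 where p2: "0 \<le> p2" "p2 \<le> sup (- x1) 0" "vdisj (sup (- x1) 0 - p2) x2" "\<And>z. vdisj x2 z \<Longrightarrow> vdisj p2 z"
      by (rule sigma_complete_projection[OF sc, of "sup (- x1) 0" x2], simp) (blast intro: that)
    define p q where "p = p1 - p2" and "q = (sup x1 0 - p1) - (sup (- x1) 0 - p2)"
    have x1: "x1 = q + p"
      using pos_minus_neg[of x1] by (simp add: p_def q_def algebra_simps)
    have q: "vdisj q x2"
      using p1(3) p2(3) by (simp add: q_def vdisj_diff)
    have p: "vdisj p z" if "vdisj x2 z" for z
      using p1(4) p2(4) that by (simp add: p_def vdisj_diff)
    have "vdisj (T x1) (T q)"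
      using band_leD[OF band] dpD q vdisj_sym by blast
    moreover have "vdisj (T p) (T q)"
      using dpD p q vdisj_sym by blast
    ultimately have "vdisj (T x1 - T p) (T q)"
      by (rule vdisj_diff)
    then have "T q = 0"
      by (simp add: x1 linear_add[OF lin])
    then have "q = 0"
      using bij_is_inj[OF bij] linear_0[OF lin] by (metis injD)
    then show ?thesis
      using p by (simp add: band_le_iff x1 vdisj_commute[of _ x2] vdisj_commute[of _ p])
  qed
  then show ?thesis
    using bij unfolding condition_beta_def by (metis bij_inv_eq_iff)
qed

section \<open>Sources of relatively uniform completeness\<close>

lemma banach_imp_ru_complete:
  assumes "banach_lattice_norm (N :: 'a::{ordered_real_vector, lattice} \<Rightarrow> real)"
  shows "ru_complete TYPE('a)"
  unfolding ru_complete_def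
proof (intro allI impI)
  have N: "lattice_norm N" and complete: "norm_complete N"
    using assms by (simp_all add: banach_lattice_norm_def)
  fix s :: "nat \<Rightarrow> 'a" assume "ru_cauchy s"
  then obtain u where u0: "0 \<le> u"
    and u: "\<And>d. 0 < d \<Longrightarrow> \<exists>K. \<forall>m\<ge>K. \<forall>n\<ge>K. vabs (s m - s n) \<le> d *\<^sub>R u"
    unfolding ru_cauchy_def by blast
  have "\<exists>K. \<forall>m\<ge>K. \<forall>n\<ge>K. N (s m - s n) < d" if "0 < d" for d
  proof -
    define c where "c = d / (N u + 1)"
    have "0 < c" and c: "c * N u < d"
      using that lattice_norm_nonneg[OF N, of u] by (simp_all add: c_def field_simps)
    then obtain K where K: "\<forall>m\<ge>K. \<forall>n\<ge>K. vabs (s m - s n) \<le> c *\<^sub>R u"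
      using u by blast
    have "N (s m - s n) < d" if "K \<le> m" "K \<le> n" for m n
    proof -
      have "vabs (s m - s n) \<le> vabs (c *\<^sub>R u)"
        using K that u0 \<open>0 < c\<close> by (simp add: vabs_scaleR vabs_of_nonneg)
      then have "N (s m - s n) \<le> N (c *\<^sub>R u)"
        by (rule lattice_norm_mono[OF N])
      then show ?thesis
        using c \<open>0 < c\<close> by (simp add: lattice_norm_scaleR[OF N])
    qed
    then show ?thesis
      by blast
  qed
  then obtain l where l: "\<And>d. 0 < d \<Longrightarrow> \<exists>K. \<forall>n\<ge>K. N (s n - l) < d"
    using complete unfolding norm_complete_def by blast
  have "ru_converges s l"
    unfolding ru_converges_def
  proof (intro exI[of _ u] conjI allI impI)
    fix d :: real assume "0 < d"
    then obtain K where K: "\<And>m n. K \<le> m \<Longrightarrow> K \<le> n \<Longrightarrow> vabs (s m - s n) \<le> d *\<^sub>R u"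
      using u by blast
    have "vabs (s n - l) \<le> d *\<^sub>R u" if n: "K \<le> n" for n
    proof -
      \<comment> \<open>The excess \<open>w\<close> lies below \<open>vabs (s m - l)\<close> for all
        large \<open>m\<close>, so its norm vanishes. The norm limit is thus a relatively uniform
        limit with the same regulator.\<close>
      define w where "w = sup (vabs (s n - l) - d *\<^sub>R u) 0"
      have "N w < c" if "0 < c" for c
      proof -
        obtain K' where K': "\<forall>n\<ge>K'. N (s n - l) < c"
          using l \<open>0 < c\<close> by blast
        define m where "m = max K K'"
        have "vabs (s n - l) \<le> vabs (s n - s m) + vabs (s m - l)"
          using vabs_triangle[of "s n - s m" "s m - l"] by simp
        also have "\<dots> \<le> d *\<^sub>R u + vabs (s m - l)"
          using K n by (simp add: m_def)
        finally have "w \<le> vabs (s m - l)"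
          by (simp add: w_def diff_le_eq add.commute)
        then have "vabs w \<le> vabs (s m - l)"
          by (simp add: w_def vabs_of_nonneg)
        then have "N w \<le> N (s m - l)"
          by (rule lattice_norm_mono[OF N])
        also have "\<dots> < c"
          using K' by (simp add: m_def)
        finally show ?thesis .
      qed
      then have "N w \<le> 0"
        by (meson less_irrefl not_le)
      then have "w = 0"
        by (rule lattice_norm_le_0_imp[OF N])
      then have "vabs (s n - l) - d *\<^sub>R u \<le> 0"
        unfolding w_def by (metis sup_ge1)
      then show ?thesis
        by simp
    qed
    then show "\<exists>K. \<forall>n\<ge>K. vabs (s n - l) \<le> d *\<^sub>R u"
      by blast
  qed fact
  then show "\<exists>l. ru_converges s l"
    by blast
qed

lemma sigma_complete_imp_ru_complete:
  assumes sc: "dedekind_sigma_complete TYPE('a::{ordered_real_vector, lattice})"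
  shows "ru_complete TYPE('a)"
  unfolding ru_complete_def
proof (intro allI impI)
  fix s :: "nat \<Rightarrow> 'a" assume "ru_cauchy s"
  then obtain u where u0: "0 \<le> u"
    and u: "\<And>d. 0 < d \<Longrightarrow> \<exists>K. \<forall>m\<ge>K. \<forall>n\<ge>K. vabs (s m - s n) \<le> d *\<^sub>R u"
    unfolding ru_cauchy_def by blast
  have u: "\<exists>K. \<forall>m\<ge>K. \<forall>n\<ge>K. s m \<le> s n + d *\<^sub>R u" if d: "0 < d" for d
  proof -
    obtain K where K: "\<And>m n. K \<le> m \<Longrightarrow> K \<le> n \<Longrightarrow> vabs (s m - s n) \<le> d *\<^sub>R u"
      using u[OF d] by blast
    have "s m \<le> s n + d *\<^sub>R u" if "K \<le> m" "K \<le> n" for m n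
      using order_trans[OF le_vabs K[OF that]] by (simp add: diff_le_eq add.commute)
    then show ?thesis
      by blast
  qed
  \<comment> \<open>The limit will be the supremum of \<open>A\<close>, the countable set of those
    elements \<open>s n - u / (j + 1)\<close> that lie below every later term. The Cauchy property
    puts such elements close under the tail and bounds \<open>A\<close> above by slightly raised
    terms.\<close>
  define r where "r p = s (fst p) - (1 / real (Suc (snd p))) *\<^sub>R u" for p
  define A where "A = r ` {p. \<forall>m\<ge>fst p. r p \<le> s m}"
  have A_mem: "s n - (1 / real (Suc j)) *\<^sub>R u \<in> A"
    if "\<forall>m\<ge>n. s n \<le> s m + (1 / real (Suc j)) *\<^sub>R u" for n j
    using that by (auto simp: A_def r_def diff_le_eq intro!: image_eqI[of _ _ "(n, j)"])
  have A_le: "a \<le> s n + d *\<^sub>R u" if "a \<in> A" and K: "\<forall>m\<ge>K. \<forall>n\<ge>K. s m \<le> s n + d *\<^sub>R u" "K \<le> n" for a n K d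
  proof -
    obtain k where "\<forall>m\<ge>k. a \<le> s m"
      using \<open>a \<in> A\<close> unfolding A_def by blast
    then have "a \<le> s (max k K)"
      by simp
    also have "\<dots> \<le> s n + d *\<^sub>R u"
      using K by simp
    finally show ?thesis .
  qed
  have "A \<noteq> {}"
  proof -
    obtain K where K: "\<forall>m\<ge>K. \<forall>n\<ge>K. s m \<le> s n + 1 *\<^sub>R u"
      using u[of 1] by auto
    then have "s K - (1 / real (Suc 0)) *\<^sub>R u \<in> A"
      by (intro A_mem) simp
    then show ?thesis
      by blast
  qed
  moreover have "\<exists>w. \<forall>a\<in>A. a \<le> w"
    using A_le u[of 1] by (metis order_refl zero_less_one)
  moreover have "countable A"
    by (simp add: A_def)
  ultimately have "countable A \<and> A \<noteq> {} \<and> (\<exists>w. \<forall>a\<in>A. a \<le> w)"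
    by blast
  then have "\<exists>l. (\<forall>a\<in>A. a \<le> l) \<and> (\<forall>w. (\<forall>a\<in>A. a \<le> w) \<longrightarrow> l \<le> w)"
    by (rule sc[unfolded dedekind_sigma_complete_def, THEN spec, THEN mp])
  then obtain l where l: "\<forall>a\<in>A. a \<le> l" "\<And>w. \<forall>a\<in>A. a \<le> w \<Longrightarrow> l \<le> w"
    by blast
  have "ru_converges s l"
    unfolding ru_converges_def
  proof (intro exI[of _ u] conjI allI impI)
    fix d :: real assume "0 < d"
    then obtain j where j: "1 / real (Suc j) < d"
      using nat_approx_posE by blast
    obtain K where K: "\<forall>m\<ge>K. \<forall>n\<ge>K. s m \<le> s n + (1 / real (Suc j)) *\<^sub>R u"
      using u[of "1 / real (Suc j)"] by auto
    have "vabs (s n - l) \<le> d *\<^sub>R u" if n: "K \<le> n" for n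
    proof -
      have "s n - (1 / real (Suc j)) *\<^sub>R u \<in> A"
        using K n by (intro A_mem) auto
      then have "s n - (1 / real (Suc j)) *\<^sub>R u \<le> l"
        using l(1) by blast
      then have 1: "s n - l \<le> (1 / real (Suc j)) *\<^sub>R u"
        by (simp only: diff_le_eq add.commute)
      have "l \<le> s n + (1 / real (Suc j)) *\<^sub>R u"
        using A_le[OF _ K n] by (intro l(2)) blast
      then have "- (s n - l) \<le> (1 / real (Suc j)) *\<^sub>R u"
        by (simp only: minus_diff_eq diff_le_eq add.commute)
      with 1 have "vabs (s n - l) \<le> (1 / real (Suc j)) *\<^sub>R u"
        by (rule vabs_leI)
      also have "\<dots> \<le> d *\<^sub>R u"
        using j u0 by (intro scaleR_right_mono) simp_all
      finally show ?thesis .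
    qed
    then show "\<exists>K. \<forall>n\<ge>K. vabs (s n - l) \<le> d *\<^sub>R u"
      by blast
  qed fact
  then show "\<exists>l. ru_converges s l"
    by blast
qed

lemma riesz_iso_vabs:
  assumes "riesz_iso J"
  shows "vabs (J x) = J (vabs x)"
proof (rule antisym)
  have lin: "linear J" and bij: "bij J" and le: "\<And>x y. J x \<le> J y \<longleftrightarrow> x \<le> y"
    using assms by (simp_all add: riesz_iso_def)
  show "vabs (J x) \<le> J (vabs x)"
    by (rule vabs_leI) (simp_all add: le le_vabs neg_le_vabs flip: linear_neg[OF lin])
  obtain y where y: "vabs (J x) = J y"
    using bij by (metis bij_pointE)
  have "J x \<le> J y" "J (- x) \<le> J y"
    using le_vabs[of "J x"] neg_le_vabs[of "J x"] by (simp_all add: y linear_neg[OF lin])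
  then show "J (vabs x) \<le> vabs (J x)"
    by (simp add: y le vabs_leI)
qed

text \<open>This reduces the case \<open>Y = X\<close> to the case of a relatively uniformly
  complete codomain. Sequences, limits and regulators are all carried along
  \<open>J\<close>.\<close>

lemma riesz_iso_ru_complete:
  fixes J :: "'a::{ordered_real_vector, lattice} \<Rightarrow> 'b::{ordered_real_vector, lattice}"
  assumes J: "riesz_iso J" and ru: "ru_complete TYPE('a)"
  shows "ru_complete TYPE('b)"
  unfolding ru_complete_def
proof (intro allI impI)
  have lin: "linear J" and bij: "bij J" and le: "\<And>x y. J x \<le> J y \<longleftrightarrow> x \<le> y"
    using J by (simp_all add: riesz_iso_def)
  have eq: "vabs (J x - J y) \<le> d *\<^sub>R J u \<longleftrightarrow> vabs (x - y) \<le> d *\<^sub>R u" for x y u and d :: real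
    by (simp add: riesz_iso_vabs[OF J] le flip: linear_diff[OF lin] linear_scale[OF lin])
  have pos: "0 \<le> J u \<longleftrightarrow> 0 \<le> u" for u
    using le[of 0 u] by (simp add: linear_0[OF lin])
  have surj: "J (inv J y) = y" for y
    using bij by (simp add: bij_is_surj surj_f_inv_f)
  fix s :: "nat \<Rightarrow> 'b" assume "ru_cauchy s"
  then obtain u where "0 \<le> u" "\<forall>d>0. \<exists>K. \<forall>m\<ge>K. \<forall>n\<ge>K. vabs (s m - s n) \<le> d *\<^sub>R u"
    unfolding ru_cauchy_def by blast
  then have "ru_cauchy (\<lambda>n. inv J (s n))"
    unfolding ru_cauchy_def by (intro exI[of _ "inv J u"]) (simp add: surj flip: eq pos)
  then obtain l v where "0 \<le> v" "\<forall>d>0. \<exists>K. \<forall>n\<ge>K. vabs (inv J (s n) - l) \<le> d *\<^sub>R v"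
    using ru unfolding ru_complete_def ru_converges_def by blast
  then have "ru_converges s (J l)"
    unfolding ru_converges_def by (intro exI[of _ "J v"]) (simp add: surj pos flip: eq)
  then show "\<exists>l. ru_converges s l"
    by blast
qed

section \<open>Disjointness preserving operators reflect disjointness\<close>

lemma vabs_le_of_disjoint:
  assumes "vabs v \<le> vabs p + vabs q" "vdisj v q"
  shows "vabs v \<le> vabs p"
proof -
  have "vabs v = inf (vabs v) (vabs p + vabs q)"
    using assms(1) by (simp add: inf_absorb1)
  also have "\<dots> \<le> inf (vabs v) (vabs p) + inf (vabs v) (vabs q)"
    by (rule inf_add_le) simp_all
  also have "\<dots> = inf (vabs v) (vabs p)"
    using assms(2) by (simp add: vdisj_def)
  also have "\<dots> \<le> vabs p"
    by simp
  finally show ?thesis .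
qed

text \<open>The images of the positive and negative parts are disjoint, so their sum and their
  difference have the same absolute value.\<close>

lemma dp_vabs:
  assumes lin: "linear T" and dp: "disjointness_preserving T"
  shows "vabs (T (vabs x)) = vabs (T x)"
proof -
  have "vdisj (T (sup x 0)) (T (sup (- x) 0))"
    using dp vdisj_pos_neg unfolding disjointness_preserving_def by blast
  then have "vabs (T (sup x 0) + T (sup (- x) 0)) = vabs (T (sup x 0) - T (sup (- x) 0))"
    by (simp add: vabs_add_disjoint vabs_diff_disjoint)
  then show ?thesis
    by (simp add: pos_minus_neg pos_plus_neg flip: linear_add[OF lin] linear_diff[OF lin])
qed

text \<open>Iterating the tent map \<open>f \<mapsto> \<bar>2 f - g\<bar>\<close> of \<open>[0, g]\<close> pushes the uncontrolled part of
  \<open>T f\<close> below any positive multiple of the bound.\<close>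

lemma dp_bounded_imp_dominated:
  fixes T :: "'a::{ordered_real_vector, lattice} \<Rightarrow> 'b::{ordered_real_vector, lattice}"
  assumes lin: "linear T" and dp: "disjointness_preserving T" and N: "lattice_norm N"
    and bounded: "\<And>h. 0 \<le> h \<Longrightarrow> h \<le> g \<Longrightarrow> N (T h) \<le> K"
    and f: "0 \<le> f" "f \<le> g"
  shows "vabs (T f) \<le> vabs (T g)"
proof -
  have iter: "\<exists>h. 0 \<le> h \<and> h \<le> g \<and>
      vabs (T f) \<le> (1 - (1/2) ^ n) *\<^sub>R vabs (T g) + (1/2) ^ n *\<^sub>R vabs (T h)"
    if "0 \<le> f" "f \<le> g" for f n
    using that
  proof (induction n arbitrary: f)
    case 0
    then show ?case by auto
  next
    case (Suc n)
    define f1 where "f1 = vabs (2 *\<^sub>R f - g)"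
    have "f - g \<le> 0" "0 \<le> f"
      using Suc.prems by simp_all
    then have "2 *\<^sub>R f - g \<le> g" "- (2 *\<^sub>R f - g) \<le> g"
      using add_mono[OF Suc.prems(2) Suc.prems(2)] add_nonneg_nonneg[OF Suc.prems(1) Suc.prems(1)]
      by (simp_all add: scaleR_2 diff_le_eq)
    then have "f1 \<le> g"
      unfolding f1_def by (rule vabs_leI)
    then obtain h where h: "0 \<le> h" "h \<le> g"
      "vabs (T f1) \<le> (1 - (1/2) ^ n) *\<^sub>R vabs (T g) + (1/2) ^ n *\<^sub>R vabs (T h)"
      using Suc.IH[of f1] by (auto simp: f1_def)
    \<comment> \<open>One tent step: half of the weight goes to \<open>g\<close>, and
      \<open>dp_vabs\<close> replaces \<open>2 f - g\<close> by its absolute value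
      \<open>f1\<close>, which is again in \<open>[0, g]\<close>.\<close>
    have "f = (1/2) *\<^sub>R (g + (2 *\<^sub>R f - g))"
      by simp
    then have "vabs (T f) = (1/2) *\<^sub>R vabs (T g + T (2 *\<^sub>R f - g))"
      by (metis linear_add[OF lin] linear_scale[OF lin] vabs_scaleR abs_of_nonneg zero_le_divide_1_iff zero_le_numeral)
    also have "\<dots> \<le> (1/2) *\<^sub>R (vabs (T g) + vabs (T f1))"
      using dp_vabs[OF lin dp, of "2 *\<^sub>R f - g"] vabs_triangle[of "T g" "T (2 *\<^sub>R f - g)"]
      by (intro scaleR_left_mono) (simp_all add: f1_def)
    also have "\<dots> \<le> (1/2) *\<^sub>R (vabs (T g) + ((1 - (1/2) ^ n) *\<^sub>R vabs (T g) + (1/2) ^ n *\<^sub>R vabs (T h)))"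
      using h(3) by (intro scaleR_left_mono add_mono) simp_all
    also have "\<dots> = (1 - (1/2) ^ Suc n) *\<^sub>R vabs (T g) + (1/2) ^ Suc n *\<^sub>R vabs (T h)"
      by (simp add: algebra_simps flip: scaleR_add_left)
    finally show ?case
      using h by blast
  qed
  define w where "w = sup (vabs (T f) - vabs (T g)) 0"
  have small: "N w \<le> K * (1/2) ^ n" for n
  proof -
    obtain h where h: "0 \<le> h" "h \<le> g"
      "vabs (T f) \<le> (1 - (1/2) ^ n) *\<^sub>R vabs (T g) + (1/2) ^ n *\<^sub>R vabs (T h)"
      using iter[OF f] by blast
    note h(3)
    also have "(1 - (1/2) ^ n) *\<^sub>R vabs (T g) \<le> 1 *\<^sub>R vabs (T g)"
      by (rule scaleR_right_mono) simp_all
    finally have "vabs (T f) - vabs (T g) \<le> vabs ((1/2) ^ n *\<^sub>R T h)"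
      by (simp add: vabs_scaleR diff_le_eq add.commute)
    then have "vabs w \<le> vabs ((1/2) ^ n *\<^sub>R T h)"
      by (simp add: w_def vabs_of_nonneg)
    then have "N w \<le> N ((1/2) ^ n *\<^sub>R T h)"
      by (rule lattice_norm_mono[OF N])
    also have "\<dots> = N (T h) * (1/2) ^ n"
      by (simp add: lattice_norm_scaleR[OF N])
    also have "\<dots> \<le> K * (1/2) ^ n"
      using bounded[OF h(1,2)] by (rule mult_right_mono) simp
    finally show ?thesis .
  qed
  have "N w \<le> 0"
  proof (rule ccontr)
    assume "\<not> N w \<le> 0"
    then obtain n where "K * (1/2) ^ n < N w"
      using half_power_small[of "N w" 0 K] by (metis not_le)
    with small[of n] show False
      by simp
  qed
  then have "w = 0"
    by (rule lattice_norm_le_0_imp[OF N])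
  then have "vabs (T f) - vabs (T g) \<le> 0"
    unfolding w_def by (metis sup_ge1)
  then show ?thesis
    by simp
qed

text \<open>The disjoint parts of \<open>f - s y\<close> cannot both be nonzero, so a nonnegative
  \<open>f\<close> is comparable with every \<open>s y\<close>, and the Archimedean property makes
  it equal to \<open>t y\<close> at the cut. This handles atoms, on whose interval every linear
  operator is bounded.\<close>

lemma multiple_if_indecomposable:
  fixes y f :: "'a::{ordered_real_vector, lattice}"
  assumes arch: "archimedean_vl TYPE('a)"
    and indec: "\<And>p q. 0 \<le> p \<Longrightarrow> p \<le> y \<Longrightarrow> 0 \<le> q \<Longrightarrow> q \<le> y \<Longrightarrow> vdisj p q \<Longrightarrow> p = 0 \<or> q = 0"
    and f: "vabs f \<le> y"
  obtains t where "f = t *\<^sub>R y"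
proof -
  have pos: "\<exists>t. f = t *\<^sub>R y" if "0 \<le> f" "f \<le> y" for f
  proof -
    have y: "0 \<le> y"
      using that order_trans by blast
    have dich: "f \<le> s *\<^sub>R y \<or> s *\<^sub>R y \<le> f" if s: "0 \<le> s" "s \<le> 1" for s
    proof -
      define p q where "p = sup (f - s *\<^sub>R y) 0" and "q = sup (- (f - s *\<^sub>R y)) 0"
      have sy: "0 \<le> s *\<^sub>R y" "s *\<^sub>R y \<le> y"
        using s y scaleR_right_mono[of s 1 y] by (simp_all add: scaleR_nonneg_nonneg)
      have "p \<le> y" "q \<le> y"
        using diff_mono[OF \<open>f \<le> y\<close> sy(1)] diff_mono[OF sy(2) \<open>0 \<le> f\<close>] y
        by (simp_all add: p_def q_def)
      moreover have "vdisj p q"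
        unfolding p_def q_def by (rule vdisj_pos_neg)
      ultimately consider "p = 0" | "q = 0"
        using indec[of p q] by (auto simp: p_def q_def)
      then show ?thesis
      proof cases
        case 1
        then have "f - s *\<^sub>R y \<le> 0"
          unfolding p_def by (metis sup_ge1)
        then show ?thesis by simp
      next
        case 2
        then have "- (f - s *\<^sub>R y) \<le> 0"
          unfolding q_def by (metis sup_ge1)
        then show ?thesis by simp
      qed
    qed
    define S where "S = {s. 0 \<le> s \<and> s \<le> 1 \<and> f \<le> s *\<^sub>R y}"
    define t where "t = Inf S"
    have "1 \<in> S"
      using \<open>f \<le> y\<close> by (simp add: S_def)
    moreover have "bdd_below S"
      by (rule bdd_belowI[of _ 0]) (simp add: S_def)
    ultimately have S: "1 \<in> S" "bdd_below S" .
    have "0 \<le> t"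
      unfolding t_def by (rule cInf_greatest) (use S(1) in \<open>blast, simp add: S_def\<close>)
    moreover have "t \<le> 1"
      unfolding t_def using S by (rule cInf_lower)
    ultimately have t: "0 \<le> t" "t \<le> 1" .
    have "f - t *\<^sub>R y \<le> 0"
    proof (rule archimedean_le_0[OF arch])
      fix e :: real assume "0 < e"
      then obtain s where s: "s \<in> S" "s < t + e"
        using S cInf_lessD[of S "t + e"] by (auto simp: t_def)
      then have "f \<le> s *\<^sub>R y"
        by (simp add: S_def)
      also have "\<dots> \<le> (t + e) *\<^sub>R y"
        using s y by (intro scaleR_right_mono) simp_all
      finally show "f - t *\<^sub>R y \<le> e *\<^sub>R y"
        by (simp add: scaleR_add_left diff_le_eq add.commute)
    qed
    moreover have "t *\<^sub>R y - f \<le> 0"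
    proof (rule archimedean_le_0[OF arch])
      fix e :: real assume e: "0 < e"
      have "(t - e) *\<^sub>R y \<le> f"
      proof (cases "t - e \<le> 0")
        case True
        then have "(t - e) *\<^sub>R y \<le> 0"
          using y by (simp add: scaleR_nonpos_nonneg)
        then show ?thesis
          using \<open>0 \<le> f\<close> by (rule order_trans)
      next
        case False
        \<comment> \<open>Below the infimum \<open>f \<le> s y\<close> fails, so comparability gives
          the reverse inequality.\<close>
        have "t - e \<notin> S"
          using cInf_lower[of "t - e" S] S(2) e by (auto simp: t_def)
        then show ?thesis
          using False t e dich[of "t - e"] by (auto simp: S_def)
      qed
      then show "t *\<^sub>R y - f \<le> e *\<^sub>R y"
        by (simp add: scaleR_diff_left algebra_simps)
    qed
    ultimately have "f = t *\<^sub>R y"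
      by (intro antisym) simp_all
    then show ?thesis ..
  qed
  have le: "sup f 0 \<le> y" "sup (- f) 0 \<le> y"
    using f order_trans[OF le_vabs f] order_trans[OF neg_le_vabs f] order_trans[OF vabs_nonneg f] by simp_all
  consider "sup f 0 = 0" | "sup (- f) 0 = 0"
    using indec[OF _ le(1) _ le(2) vdisj_pos_neg] by auto
  then show ?thesis
  proof cases
    case 1
    obtain t where "sup (- f) 0 = t *\<^sub>R y"
      using pos[of "sup (- f) 0"] le by auto
    then have "f = (- t) *\<^sub>R y"
      using pos_minus_neg[of f] 1 by simp
    then show ?thesis by (rule that)
  next
    case 2
    obtain t where "sup f 0 = t *\<^sub>R y"
      using pos[of "sup f 0"] le by auto
    then have "f = t *\<^sub>R y"
      using pos_minus_neg[of f] 2 by simp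
    then show ?thesis by (rule that)
  qed
qed

text \<open>If \<open>T\<close> were unbounded on every interval below \<open>c\<close>, no such
  interval could belong to an atom, so each \<open>y\<close> splits into disjoint \<open>p y\<close>
  and \<open>q y\<close>. Splitting \<open>p y\<close> again and again leaves pairwise disjoint
  \<open>q (y n)\<close>, each with room for a hump of image norm above
  \<open>4 ^ n\<close>.\<close>

lemma dp_locally_bounded:
  fixes T :: "'a::{ordered_real_vector, lattice} \<Rightarrow> 'b::{ordered_real_vector, lattice}"
  assumes arch: "archimedean_vl TYPE('a)" and ru: "ru_complete TYPE('a)"
    and N: "lattice_norm N" and lin: "linear T" and dp: "disjointness_preserving T"
    and c: "0 \<le> c" "c \<noteq> 0"
  obtains x K where "0 \<le> x" "x \<le> c" "x \<noteq> 0" "\<And>f. vabs f \<le> x \<Longrightarrow> N (T f) \<le> K"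
proof (rule ccontr)
  define P where "P x \<longleftrightarrow> 0 \<le> x \<and> x \<le> c \<and> x \<noteq> 0" for x
  assume "\<not> thesis"
  then have unbounded: "\<exists>f. vabs f \<le> x \<and> K < N (T f)" if "P x" for x K
    using that \<open>\<And>x K. \<lbrakk>0 \<le> x; x \<le> c; x \<noteq> 0; \<And>f. vabs f \<le> x \<Longrightarrow> N (T f) \<le> K\<rbrakk> \<Longrightarrow> thesis\<close>
    unfolding P_def by (meson not_le)
  have "\<exists>p q. P p \<and> P q \<and> p \<le> y \<and> q \<le> y \<and> vdisj p q" if y: "P y" for y
  proof (rule ccontr)
    assume no: "\<not> ?thesis"
    have "p = 0 \<or> q = 0" if "0 \<le> p" "p \<le> y" "0 \<le> q" "q \<le> y" "vdisj p q" for p q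
      using no that y unfolding P_def by (meson order_trans)
    then have mult: "\<exists>t. f = t *\<^sub>R y" if "vabs f \<le> y" for f
      using multiple_if_indecomposable[OF arch _ that] by metis
    \<comment> \<open>With the bound \<open>N (T y)\<close> itself, \<open>f\<close> would be a
      multiple \<open>t y\<close> with \<open>\<bar>t\<bar> \<le> 1\<close>, whose image cannot be
      larger.\<close>
    obtain f where f: "vabs f \<le> y" "N (T y) < N (T f)"
      using unbounded[OF y] by blast
    obtain t where t: "f = t *\<^sub>R y"
      using mult[OF f(1)] ..
    have "\<bar>t\<bar> *\<^sub>R y \<le> 1 *\<^sub>R y"
      using f(1) y by (simp add: t vabs_scaleR vabs_of_nonneg P_def)
    have "\<bar>t\<bar> \<le> 1"
    proof (rule ccontr)
      assume "\<not> \<bar>t\<bar> \<le> 1"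
      moreover have "(\<bar>t\<bar> - 1) *\<^sub>R y \<le> 0"
        using \<open>\<bar>t\<bar> *\<^sub>R y \<le> 1 *\<^sub>R y\<close> by (simp add: scaleR_diff_left)
      ultimately have "inverse (\<bar>t\<bar> - 1) *\<^sub>R ((\<bar>t\<bar> - 1) *\<^sub>R y) \<le> inverse (\<bar>t\<bar> - 1) *\<^sub>R 0"
        by (intro scaleR_left_mono) simp_all
      then have "y \<le> 0"
        using \<open>\<not> \<bar>t\<bar> \<le> 1\<close> by simp
      then show False
        using y by (auto simp: P_def)
    qed
    then have "N (T f) \<le> N (T y)"
      using mult_right_mono[of "\<bar>t\<bar>" 1 "N (T y)"]
      by (simp add: t linear_scale[OF lin] lattice_norm_scaleR[OF N] lattice_norm_nonneg[OF N])
    with f(2) show False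
      by simp
  qed
  then obtain p q where pq: "\<And>y. P y \<Longrightarrow> P (p y)" "\<And>y. P y \<Longrightarrow> P (q y)"
    "\<And>y. P y \<Longrightarrow> p y \<le> y" "\<And>y. P y \<Longrightarrow> q y \<le> y" "\<And>y. P y \<Longrightarrow> vdisj (p y) (q y)"
    by metis
  define y where "y n = (p ^^ n) c" for n
  have Py: "P (y n)" for n
    by (induction n) (use c pq in \<open>simp_all add: y_def P_def\<close>)
  have y_mono: "y m \<le> y n" if "n \<le> m" for m n
    using that by (induction m rule: dec_induct) (auto simp: y_def intro: order_trans[OF pq(3)] Py[unfolded y_def])
  have "\<forall>n. \<exists>f. vabs f \<le> q (y n) \<and> 4 ^ n < N (T f)"
    using unbounded[OF pq(2)[OF Py]] by blast
  then obtain f where f: "\<And>n. vabs (f n) \<le> q (y n)" "\<And>n. 4 ^ n < N (T (f n))"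
    by metis
  have q: "vabs (q (y n)) = q (y n)" for n
    using pq(2)[OF Py] by (simp add: P_def vabs_of_nonneg)
  have *: "vdisj (f k) (f n)" if "n < k" for n k
  proof -
    have "q (y k) \<le> p (y n)"
      using pq(4)[OF Py, of k] y_mono[of "Suc n" k] that by (simp add: y_def)
    moreover have "vabs (p (y n)) = p (y n)"
      using pq(1)[OF Py] by (simp add: P_def vabs_of_nonneg)
    ultimately have "vabs (f k) \<le> vabs (p (y n))"
      using f(1) order_trans by metis
    moreover have "vabs (f n) \<le> vabs (q (y n))"
      using f(1) q by metis
    ultimately show ?thesis
      using pq(5)[OF Py, of n] vdisj_mono vdisj_sym by blast
  qed
  have disj: "vdisj (f k) (f n)" if "k \<noteq> n" for n k
    using that *[of n k] *[of k n] by (cases k n rule: linorder_cases) (simp_all add: vdisj_commute)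
  have "\<exists>n. N (T (f n)) < 4 ^ n"
  proof (rule gliding_hump[OF arch ru N lin])
    show "vabs (f n) \<le> c" for n
      using f(1) pq(2)[OF Py, of n] unfolding P_def by (meson order_trans)
    \<comment> \<open>The hypothesis on \<open>g\<close> is used with \<open>z = f n\<close>, which
      is disjoint from all other humps.\<close>
    show "vdisj (T g) (T (f n))" if "\<And>z. (\<And>k. k \<noteq> n \<Longrightarrow> vdisj (f k) z) \<Longrightarrow> vdisj g z" for n g
      using that[of "f n"] disj dp by (simp add: disjointness_preserving_def)
  qed
  then show False
    using f(2) by (meson not_less_iff_gr_or_eq)
qed

text \<open>Otherwise some nonzero \<open>x\<close> below both \<open>A\<close> and \<open>B\<close>
  has \<open>T\<close> bounded on its interval. The element \<open>y\<close> lives where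
  \<open>k x\<close> exceeds \<open>A + B\<close>. There neither \<open>A\<close> nor
  \<open>B\<close> is affected by truncation at \<open>k x\<close>, so \<open>T y\<close> is
  dominated by both \<open>T A\<close> and \<open>T B\<close>. These are disjoint, which forces
  \<open>y = 0\<close>.\<close>

lemma dp_reflects_disjoint:
  fixes T :: "'a::{ordered_real_vector, lattice} \<Rightarrow> 'b::{ordered_real_vector, lattice}"
  assumes arch: "archimedean_vl TYPE('a)" and ru: "ru_complete TYPE('a)"
    and N: "lattice_norm (N :: 'b \<Rightarrow> real)" and lin: "linear T" and inj: "inj T" and dp: "disjointness_preserving T"
    and disj: "vdisj (T a) (T b)"
  shows "vdisj a b"
proof (rule ccontr)
  assume "\<not> vdisj a b"
  define A B where "A = vabs a" and "B = vabs b"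
  have AB: "0 \<le> A" "0 \<le> B" "vdisj (T A) (T B)"
    using disj by (simp_all add: A_def B_def vdisj_def dp_vabs[OF lin dp])
  have "0 \<le> inf A B" "inf A B \<noteq> 0"
    using AB \<open>\<not> vdisj a b\<close> by (simp_all add: A_def B_def vdisj_def)
  then obtain x K where x: "0 \<le> x" "x \<le> inf A B" "x \<noteq> 0" "\<And>f. vabs f \<le> x \<Longrightarrow> N (T f) \<le> K"
    by (rule dp_locally_bounded[OF arch ru N lin dp]) (blast intro: that)
  \<comment> \<open>This choice of \<open>k\<close> is exactly what makes \<open>y\<close> below
    nonzero.\<close>
  obtain k where k: "\<not> real k *\<^sub>R x \<le> A + B"
    using arch x(1,3) unfolding archimedean_vl_def by blast
  have "k \<noteq> 0"
    using k AB by (cases "k = 0") simp_all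
  then have k1: "1 \<le> real k"
    by simp
  define y where "y = sup (x - (1 / real k) *\<^sub>R (A + B)) 0"
  have dominated: "vabs (T y) \<le> vabs (T C)" if C: "0 \<le> C" "x \<le> C" "C \<le> A + B" for C
  proof -
    \<comment> \<open>\<open>T\<close> is bounded on \<open>[0, C']\<close> because
      \<open>C'\<close> lies below \<open>k x\<close>, so domination applies to \<open>C'\<close>.
      The cut-off rest \<open>C - C'\<close> is disjoint from \<open>y\<close>, and its image drops
      out of the bound for \<open>T y\<close>.\<close>
    define C' where "C' = inf C (real k *\<^sub>R x)"
    define w where "w = real k *\<^sub>R x - C"
    have "x - (1 / real k) *\<^sub>R (A + B) \<le> x - (1 / real k) *\<^sub>R C"
      using C(3) by (intro diff_mono scaleR_left_mono) simp_all
    also have "\<dots> = (1 / real k) *\<^sub>R w"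
      using k1 by (simp add: w_def scaleR_diff_right)
    also have "\<dots> \<le> (1 / real k) *\<^sub>R sup w 0"
      by (intro scaleR_left_mono) simp_all
    finally have "y \<le> (1 / real k) *\<^sub>R sup w 0"
      by (simp add: y_def scaleR_nonneg_nonneg)
    then have "vabs y \<le> (1 / real k) *\<^sub>R vabs (sup w 0)"
      by (simp add: y_def vabs_of_nonneg)
    moreover have "C - C' = sup (- w) 0"
    proof -
      have "C - C' = sup (- C) (- (real k *\<^sub>R x)) + C"
        by (simp add: C'_def flip: neg_inf_eq)
      also have "\<dots> = sup (- w) 0"
        by (simp add: sup_add_right w_def sup_commute)
      finally show ?thesis .
    qed
    ultimately have "vdisj y (C - C')"
      using vdisj_le_scaleR[OF vdisj_pos_neg] by metis
    then have *: "vdisj (T y) (T (C - C'))"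
      using dp by (simp add: disjointness_preserving_def)
    have yx: "y \<le> x"
    proof -
      have "x - (1 / real k) *\<^sub>R (A + B) \<le> x - 0"
        using AB by (intro diff_mono) (simp_all add: scaleR_nonneg_nonneg)
      then show ?thesis
        using x(1) by (simp add: y_def)
    qed
    have "x \<le> real k *\<^sub>R x"
      using scaleR_right_mono[OF k1 x(1)] by simp
    then have "y \<le> C'"
      using yx C(2) by (simp add: C'_def order_trans[OF yx])
    have "vabs (T y) \<le> vabs (T C')"
    proof (rule dp_bounded_imp_dominated[OF lin dp N])
      fix h assume h: "0 \<le> h" "h \<le> C'"
      have "h \<le> real k *\<^sub>R x"
        using h(2) by (simp add: C'_def)
      then have "(1 / real k) *\<^sub>R h \<le> (1 / real k) *\<^sub>R (real k *\<^sub>R x)"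
        by (intro scaleR_left_mono) simp_all
      then have "vabs ((1 / real k) *\<^sub>R h) \<le> x"
        using h(1) k1 by (simp add: vabs_scaleR vabs_of_nonneg)
      then have "N (T ((1 / real k) *\<^sub>R h)) \<le> K"
        by (rule x(4))
      then show "N (T h) \<le> K * real k"
        using k1 by (simp add: linear_scale[OF lin] lattice_norm_scaleR[OF N] field_simps)
    qed (simp add: y_def, fact)
    also have "\<dots> \<le> vabs (T C) + vabs (T (C - C'))"
      using vabs_triangle_diff[of "T C" "T (C - C')"] by (simp add: linear_diff[OF lin])
    finally show ?thesis
      using * by (rule vabs_le_of_disjoint)
  qed
  have "vabs (T y) \<le> inf (vabs (T A)) (vabs (T B))"
    using dominated[of A] dominated[of B] AB x(2) by simp
  also have "\<dots> = 0"
    using AB(3) by (simp add: vdisj_def)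
  finally have "T y = 0"
    using antisym[OF _ vabs_nonneg] by (metis vabs_eq_0_iff)
  then have "y = 0"
    using inj linear_0[OF lin] by (metis injD)
  then have "x - (1 / real k) *\<^sub>R (A + B) \<le> 0"
    unfolding y_def by (metis sup_ge1)
  then have "real k *\<^sub>R x \<le> real k *\<^sub>R ((1 / real k) *\<^sub>R (A + B))"
    by (intro scaleR_left_mono) simp_all
  then show False
    using k k1 by simp
qed

section \<open>Operators satisfying condition (beta)\<close>

text \<open>For disjoint \<open>c\<close> and \<open>d\<close> the absolute value of
  \<open>c - d\<close> is a sum, so Riesz decomposition splits \<open>e\<close> into components in
  the two bands.\<close>

lemma disjoint_component:
  assumes cd: "vdisj c d" and le: "vabs e \<le> C *\<^sub>R vabs (c - d)" and C: "0 \<le> C"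
  obtains e' e'' where "e = e' + e''" "vabs e' \<le> C *\<^sub>R vabs c" "vabs e'' \<le> C *\<^sub>R vabs d"
    "vabs e' \<le> vabs e" "vabs e'' \<le> vabs e" "vdisj e' e''"
proof -
  have "vabs e \<le> C *\<^sub>R vabs c + C *\<^sub>R vabs d"
    using le by (simp add: vabs_diff_disjoint[OF cd] scaleR_add_right)
  then obtain p q where pq: "e = p + q" "vabs p \<le> C *\<^sub>R vabs c" "vabs q \<le> C *\<^sub>R vabs d"
    "vabs p \<le> vabs e" "vabs q \<le> vabs e"
    by (rule riesz_decomposition) (use C in \<open>simp_all add: scaleR_nonneg_nonneg\<close>)
  have "vdisj p d"
    using cd pq(2) by (rule vdisj_le_scaleR)
  then have "vdisj q p"
    using vdisj_le_scaleR[OF vdisj_sym pq(3)] by blast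
  then show ?thesis
    using that pq vdisj_sym by blast
qed

text \<open>\<open>same_sign g b\<close> says that \<open>g\<close> is nonnegative where \<open>b > 0\<close> and nonpositive where \<open>b < 0\<close>.\<close>

definition same_sign :: "'a::{ordered_real_vector, lattice} \<Rightarrow> 'a \<Rightarrow> bool" where
  "same_sign g b \<longleftrightarrow> vdisj (sup g 0) (sup (- b) 0) \<and> vdisj (sup (- g) 0) (sup b 0)"

lemma vdisj_pos_add:
  assumes "vdisj (sup x 0) z" "vdisj (sup y 0) z"
  shows "vdisj (sup (x + y) 0) z"
  using assms by (rule vdisj_le_add) (simp only: vabs_of_nonneg sup_ge2 pos_add_le)

lemma same_sign_add:
  assumes "same_sign g b" "same_sign h b"
  shows "same_sign (g + h) b"
  using assms vdisj_pos_add[of g _ h] vdisj_pos_add[of "- g" _ "- h"]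
  by (simp add: same_sign_def)

text \<open>The negative part of \<open>b' + b''\<close> is at most the sum of the two negative
  parts, and both of these are disjoint from the positive part of \<open>b'\<close>. The other half
  follows by changing signs.\<close>

lemma same_sign_component:
  assumes "b = b' + b''" "vdisj b' b''"
  shows "same_sign b' b"
proof -
  have *: "vdisj (sup x 0) (sup (- (x + y)) 0)" if "vdisj x y" for x y :: "'a::{ordered_real_vector, lattice}"
  proof -
    have "vdisj (sup (- x) 0) (sup x 0)"
      by (rule vdisj_sym[OF vdisj_pos_neg])
    moreover have "vdisj (sup (- y) 0) (sup x 0)"
      by (rule vdisj_mono[OF _ vabs_neg_le], rule vdisj_sym, rule vdisj_mono[OF that vabs_pos_le])
    ultimately have "vdisj (sup (- x + - y) 0) (sup x 0)"
      by (rule vdisj_pos_add)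
    then show ?thesis
      by (simp add: vdisj_commute)
  qed
  show ?thesis
    using *[of b' b''] *[of "- b'" "- b''"] assms by (simp add: same_sign_def add.commute)
qed

text \<open>Nothing cancels in \<open>g + b\<close>: the sum of the positive parts is disjoint from
  the sum of the negative parts.\<close>

lemma same_sign_vabs_le:
  assumes "same_sign g b"
  shows "vabs b \<le> vabs (g + b)"
proof -
  define p q where "p = sup g 0 + sup b 0" and "q = sup (- g) 0 + sup (- b) 0"
  have nonneg: "0 \<le> p" "0 \<le> q"
    by (simp_all add: p_def q_def add_nonneg_nonneg)
  have "vdisj (sup g 0) q" "vdisj (sup b 0) q"
    unfolding q_def using assms vdisj_pos_neg[of g] vdisj_pos_neg[of b]
    by (simp_all add: same_sign_def vdisj_add_right vdisj_sym[of _ "sup b 0"])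
  then have "vdisj p q"
    unfolding p_def by (rule vdisj_add)
  moreover have "p - q = g + b"
    using pos_minus_neg[of g] pos_minus_neg[of b] by (simp add: p_def q_def algebra_simps)
  ultimately have "vabs (g + b) = p + q"
    using vabs_diff_disjoint[of p q] nonneg by (simp add: vabs_of_nonneg)
  moreover have "sup b 0 + sup (- b) 0 \<le> p + q"
    unfolding p_def q_def by (intro add_mono) (simp_all add: add_increasing)
  ultimately show ?thesis
    by (simp add: pos_plus_neg)
qed

lemma linear_inv:
  assumes lin: "linear T" and bij: "bij T"
  shows "linear (inv T)"
proof (rule linearI)
  have T_inv: "T (inv T y) = y" for y
    using bij by (simp add: bij_is_surj surj_f_inv_f)
  show "inv T (x + y) = inv T x + inv T y" for x y
    by (rule injD[OF bij_is_inj[OF bij]]) (simp add: T_inv linear_add[OF lin])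
  show "inv T (c *\<^sub>R x) = c *\<^sub>R inv T x" for c x
    by (rule injD[OF bij_is_inj[OF bij]]) (simp add: T_inv linear_scale[OF lin])
qed

section \<open>Bijections with condition (beta) and dominated elements\<close>

context
  fixes T :: "'a::{ordered_real_vector, lattice} \<Rightarrow> 'b::{ordered_real_vector, lattice}"
  assumes lin: "linear T" and bij: "bij T" and beta: "condition_beta T"
begin

lemma band_le_image: "vabs x \<le> C *\<^sub>R vabs y \<Longrightarrow> band_le (T x) (T y)"
  using beta band_leI_le unfolding condition_beta_def by blast

lemma image_eq_0_iff: "T x = 0 \<longleftrightarrow> x = 0"
  using bij_is_inj[OF bij] linear_0[OF lin] by (metis injD)

lemma reflects_disjoint: "vdisj (T x) (T y) \<Longrightarrow> vdisj x y"
  by (rule condition_beta_reflects_disjoint[OF lin bij_is_inj[OF bij] beta])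

text \<open>The positive and negative parts of \<open>T x\<close> come from disjoint elements, so condition (beta)
  splits every element dominated by \<open>x\<close> along them.\<close>

lemma split_image:
  obtains c d where "vdisj c d" "x = c - d" "T c = sup (T x) 0" "T d = sup (- T x) 0"
proof -
  obtain c d where cd: "T c = sup (T x) 0" "T d = sup (- T x) 0"
    using bij by (metis bij_pointE)
  then have "vdisj c d"
    using reflects_disjoint vdisj_pos_neg by metis
  moreover have "T x = T (c - d)"
    by (simp add: linear_diff[OF lin] cd pos_minus_neg)
  then have "x = c - d"
    using bij_is_inj[OF bij] by (rule injD[rotated])
  ultimately show ?thesis
    using cd that by blast
qed

text \<open>As \<open>T\<close> is not yet known to preserve disjointness, disjoint images come only
  from pairs such as those of \<open>split_image\<close>. Condition (beta) extends this from
  \<open>c\<close> and \<open>d\<close> to everything dominated by them.\<close>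

lemma vdisj_images:
  assumes "vabs e \<le> C *\<^sub>R vabs c" "vabs e' \<le> D *\<^sub>R vabs d" "vdisj (T c) (T d)"
  shows "vdisj (T e) (T e')"
  using band_leD[OF band_le_image[OF assms(1)] vdisj_sym[OF band_leD[OF band_le_image[OF assms(2)] vdisj_sym[OF assms(3)]]]] .

text \<open>Such a \<open>b\<close> witnesses that \<open>T\<close> fails to preserve disjointness:
  disjoint images would force \<open>T a = 0\<close>. The aim is to show that no dominated element
  exists.\<close>

definition dominated :: "'a \<Rightarrow> bool" where
  "dominated b \<longleftrightarrow> (\<exists>a. vdisj a b \<and> a \<noteq> 0 \<and> 0 \<le> T a \<and> T a \<le> T b)"

text \<open>If no level \<open>s\<close> separated \<open>T a\<close> into two nonzero parts, then \<open>T a = t T b\<close> on the support of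
  \<open>T a\<close> for a fixed \<open>t\<close>, against \<open>a \<lhd> a - t b\<close>.\<close>

lemma exists_separating_level:
  assumes arch: "archimedean_vl TYPE('b)"
    and disj: "vdisj a b" and a: "a \<noteq> 0" and le: "0 \<le> T a" "T a \<le> T b"
  obtains s where "0 < s" "\<not> T a \<le> s *\<^sub>R T b" "\<not> vdisj (T a) (sup (s *\<^sub>R T b - T a) 0)"
proof (rule ccontr)
  define u v where "u = T a" and "v = T b"
  assume "\<not> thesis"
  then have no: "u \<le> s *\<^sub>R v \<or> vdisj u (sup (s *\<^sub>R v - u) 0)" if "0 < s" for s
    using that \<open>\<And>s. \<lbrakk>0 < s; \<not> T a \<le> s *\<^sub>R T b; \<not> vdisj (T a) (sup (s *\<^sub>R T b - T a) 0)\<rbrakk> \<Longrightarrow> thesis\<close>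
    unfolding u_def v_def by blast
  have uv: "0 \<le> u" "u \<le> v"
    using le by (simp_all add: u_def v_def)
  then have v: "0 \<le> v"
    by (rule order_trans)
  define S where "S = {s. 0 \<le> s \<and> u \<le> s *\<^sub>R v}"
  define t where "t = Inf S"
  have "1 \<in> S"
    using uv by (simp add: S_def)
  have bdd: "bdd_below S"
    by (rule bdd_belowI[of _ 0]) (simp add: S_def)
  have t0: "0 \<le> t"
    unfolding t_def by (rule cInf_greatest) (use \<open>1 \<in> S\<close> in \<open>blast, simp add: S_def\<close>)
  have "u - t *\<^sub>R v \<le> 0"
  proof (rule archimedean_le_0[OF arch])
    fix e :: real assume "0 < e"
    then obtain s where s: "s \<in> S" "s < t + e"
      using \<open>1 \<in> S\<close> cInf_lessD[of S "t + e"] by (auto simp: t_def)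
    then have "u \<le> s *\<^sub>R v"
      by (simp add: S_def)
    also have "\<dots> \<le> (t + e) *\<^sub>R v"
      using s v by (intro scaleR_right_mono) simp_all
    finally show "u - t *\<^sub>R v \<le> e *\<^sub>R v"
      by (simp add: scaleR_add_left diff_le_eq add.commute)
  qed
  then have q0: "0 \<le> t *\<^sub>R v - u"
    by simp
  have "t \<noteq> 0"
  proof
    assume "t = 0"
    then have "u = 0"
      using q0 uv by (intro antisym) simp_all
    then show False
      using a by (simp add: u_def image_eq_0_iff)
  qed
  have "inf u (t *\<^sub>R v - u) \<le> 0"
  proof (rule archimedean_le_0[OF arch])
    fix e :: real assume e: "0 < e"
    \<comment> \<open>The alternative \<open>t / 2\<close> keeps the level positive, as
      \<open>no\<close> requires, while \<open>s\<close> stays within \<open>e\<close> below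
      \<open>t\<close>.\<close>
    define s where "s = max (t - e) (t / 2)"
    have s: "0 < s" "s < t" "t - s \<le> e"
      using \<open>t \<noteq> 0\<close> t0 e by (auto simp: s_def max_def)
    have "s \<notin> S"
      using cInf_lower[OF _ bdd, of s] s by (auto simp: t_def)
    then have *: "vdisj u (sup (s *\<^sub>R v - u) 0)"
      using no[of s] s by (auto simp: S_def)
    have "t *\<^sub>R v - u = (s *\<^sub>R v - u) + (t - s) *\<^sub>R v"
      by (simp add: scaleR_diff_left)
    also have "\<dots> \<le> sup (s *\<^sub>R v - u) 0 + (t - s) *\<^sub>R v"
      by (intro add_mono) simp_all
    finally have "inf u (t *\<^sub>R v - u) \<le> inf u (sup (s *\<^sub>R v - u) 0 + (t - s) *\<^sub>R v)"
      by (rule inf_mono[OF order_refl])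
    also have "\<dots> \<le> inf u (sup (s *\<^sub>R v - u) 0) + inf u ((t - s) *\<^sub>R v)"
      using uv v s by (intro inf_add_le) (simp_all add: scaleR_nonneg_nonneg)
    also have "\<dots> \<le> 0 + (t - s) *\<^sub>R v"
      using * uv by (intro add_mono) (simp_all add: vdisj_def vabs_of_nonneg)
    also have "\<dots> \<le> 0 + e *\<^sub>R v"
      using s v by (intro add_mono scaleR_right_mono) simp_all
    finally show "inf u (t *\<^sub>R v - u) \<le> e *\<^sub>R v"
      by simp
  qed
  then have "vdisj u (t *\<^sub>R v - u)"
    using uv q0 by (simp add: vdisj_iff_le vabs_of_nonneg)
  then have "vdisj (T (a - t *\<^sub>R b)) u"
    using vdisj_minus(1)[of "t *\<^sub>R v - u" u] by (simp add: u_def v_def linear_diff[OF lin] linear_scale[OF lin] vdisj_commute)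
  moreover have "vdisj a (t *\<^sub>R b)"
    using disj by (rule vdisj_scaleR_right)
  then have "band_le (T a) (T (a - t *\<^sub>R b))"
    by (intro band_le_image[of _ 1]) (simp add: vabs_diff_disjoint)
  ultimately have "vdisj u u"
    unfolding u_def using band_leD by blast
  then show False
    using a by (simp add: u_def image_eq_0_iff)
qed

text \<open>Both \<open>a\<close> and \<open>b\<close> are cut along the regions
  \<open>T a > s T b\<close> and \<open>T a < s T b\<close>. Pieces from different regions have
  disjoint images, so the inequalities between \<open>T a\<close> and \<open>T b\<close> pass to the
  pieces.\<close>

lemma dominated_split:
  assumes arch: "archimedean_vl TYPE('b)" and "dominated b"
  obtains b' b'' where "dominated b'" "dominated b''" "b = b' + b''" "vdisj b' b''" "vdisj (T b') (T b'')"
proof -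
  obtain a where ab: "vdisj a b" "a \<noteq> 0" "0 \<le> T a" "T a \<le> T b"
    using \<open>dominated b\<close> unfolding dominated_def by blast
  obtain s where s: "0 < s" "\<not> T a \<le> s *\<^sub>R T b" "\<not> vdisj (T a) (sup (s *\<^sub>R T b - T a) 0)"
    by (rule exists_separating_level[OF arch ab])
  obtain c d where cd: "vdisj c d" "a - s *\<^sub>R b = c - d"
    "T c = sup (T (a - s *\<^sub>R b)) 0" "T d = sup (- T (a - s *\<^sub>R b)) 0"
    by (rule split_image)
  have Tc: "T c = sup (T a - s *\<^sub>R T b) 0" and Td: "T d = sup (s *\<^sub>R T b - T a) 0"
    using cd(3,4) by (simp_all add: linear_diff[OF lin] linear_scale[OF lin])
  have Tcd: "vdisj (T c) (T d)"
    unfolding cd(3,4) by (rule vdisj_pos_neg)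
  have "vdisj a (s *\<^sub>R b)"
    using ab(1) by (rule vdisj_scaleR_right)
  \<comment> \<open>Because \<open>a\<close> and \<open>s b\<close> are disjoint, nothing cancels,
    so both \<open>a\<close> and \<open>b\<close> are dominated by multiples of \<open>c - d\<close>
    and can be split along \<open>c\<close> and \<open>d\<close>.\<close>
  then have sum: "vabs (c - d) = vabs a + s *\<^sub>R vabs b"
    using s by (simp add: vabs_diff_disjoint vabs_scaleR flip: cd(2))
  have "vabs a \<le> 1 *\<^sub>R vabs (c - d)"
    using s by (simp add: sum scaleR_nonneg_nonneg)
  then obtain a1 a2 where a: "a = a1 + a2" "vabs a1 \<le> 1 *\<^sub>R vabs c" "vabs a2 \<le> 1 *\<^sub>R vabs d"
    "vabs a1 \<le> vabs a" "vabs a2 \<le> vabs a" "vdisj a1 a2"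
    by (rule disjoint_component[OF cd(1)]) simp
  have "(1 / s) *\<^sub>R (s *\<^sub>R vabs b) \<le> (1 / s) *\<^sub>R vabs (c - d)"
    using s by (intro scaleR_left_mono) (simp_all add: sum)
  then have "vabs b \<le> (1 / s) *\<^sub>R vabs (c - d)"
    using s by simp
  then obtain b1 b2 where b: "b = b1 + b2" "vabs b1 \<le> (1 / s) *\<^sub>R vabs c" "vabs b2 \<le> (1 / s) *\<^sub>R vabs d"
    "vabs b1 \<le> vabs b" "vabs b2 \<le> vabs b" "vdisj b1 b2"
    by (rule disjoint_component[OF cd(1)]) (use s in simp)
  have dis: "vdisj (T a1) (T a2)" "vdisj (T b1) (T a2)" "vdisj (T a1) (T b2)" "vdisj (T b1) (T b2)"
    by (rule vdisj_images[OF _ _ Tcd]; fact a b)+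
  have ab': "vdisj a1 b1" "vdisj a2 b2"
    using vdisj_mono[OF vdisj_sym[OF vdisj_mono[OF ab(1) a(4)]] b(4)]
      vdisj_mono[OF vdisj_sym[OF vdisj_mono[OF ab(1) a(5)]] b(5)] by (simp_all add: vdisj_commute)
  have sa: "T a1 + T a2 = T a" "T a2 + T a1 = T a"
    by (simp_all add: a(1) linear_add[OF lin] add.commute)
  have pos: "0 \<le> T a1" "0 \<le> T a2"
    by (rule vdisj_nonneg_addD[OF dis(1)], simp add: sa ab)
      (rule vdisj_nonneg_addD[OF vdisj_sym[OF dis(1)]], simp add: sa ab)
  have sb: "(T b1 - T a1) + (T b2 - T a2) = T b - T a" "(T b2 - T a2) + (T b1 - T a1) = T b - T a"
    by (simp_all add: a(1) b(1) linear_add[OF lin])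
  have "vdisj (T b1 - T a1) (T b2 - T a2)"
    using dis by (simp add: vdisj_diff vdisj_diff_right)
  then have "0 \<le> T b1 - T a1" "0 \<le> T b2 - T a2"
    using vdisj_nonneg_addD[of "T b1 - T a1" "T b2 - T a2"] vdisj_nonneg_addD[of "T b2 - T a2" "T b1 - T a1"] ab(4)
    unfolding sb by (simp_all add: vdisj_commute)
  then have dom: "T a1 \<le> T b1" "T a2 \<le> T b2"
    by simp_all
  \<comment> \<open>The two properties of the level \<open>s\<close> enter here: an empty first
    piece would give \<open>T a \<le> s T b\<close>, and an empty second one would make
    \<open>T a\<close> disjoint from \<open>T d\<close>.\<close>
  have "a1 \<noteq> 0"
  proof
    assume "a1 = 0"
    then have "vdisj (T a) (T c)"
      using vdisj_images[OF a(3) _ vdisj_sym[OF Tcd], of c 1] a(1) by simp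
    moreover have "T a - s *\<^sub>R T b \<le> T a - 0"
      using ab s order_trans[OF ab(3,4)] by (intro diff_mono) (simp_all add: scaleR_nonneg_nonneg)
    then have "vabs (T c) \<le> vabs (T a)"
      using ab by (simp add: Tc vabs_of_nonneg)
    ultimately have "vdisj (T c) (T c)"
      by (rule vdisj_mono)
    then have "T a - s *\<^sub>R T b \<le> 0"
      unfolding vdisj_self Tc by (metis sup_ge1)
    then show False
      using s by simp
  qed
  moreover have "a2 \<noteq> 0"
  proof
    assume "a2 = 0"
    then have "vdisj (T a) (T d)"
      using vdisj_images[OF a(2) _ Tcd, of d 1] a(1) by simp
    then show False
      using s(3) by (simp add: Td)
  qed
  ultimately have "dominated b1" "dominated b2"
    unfolding dominated_def using ab' pos dom by blast+
  then show ?thesis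
    using that b dis by blast
qed

text \<open>If \<open>T\<close> were unbounded under every dominated element, repeated splitting of
  \<open>b\<close> would give pieces \<open>g n\<close> with disjoint images and a hump of image
  norm above \<open>4 ^ n\<close> under each, against \<open>gliding_hump\<close>.\<close>

lemma dominated_bounded:
  assumes archX: "archimedean_vl TYPE('a)" and archY: "archimedean_vl TYPE('b)"
    and ru: "ru_complete TYPE('a)" and N: "lattice_norm N" and b: "dominated b"
  obtains b' K where "dominated b'" "\<And>f. vabs f \<le> vabs b' \<Longrightarrow> N (T f) \<le> K"
proof (rule ccontr)
  assume "\<not> thesis"
  then have unbounded: "\<exists>f. vabs f \<le> vabs x \<and> K < N (T f)" if "dominated x" for x K
    using that \<open>\<And>b' K. \<lbrakk>dominated b'; \<And>f. vabs f \<le> vabs b' \<Longrightarrow> N (T f) \<le> K\<rbrakk> \<Longrightarrow> thesis\<close>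
    by (meson not_le)
  have "\<exists>p q. dominated p \<and> dominated q \<and> y = p + q \<and> vdisj p q \<and> vdisj (T p) (T q)" if "dominated y" for y
    using dominated_split[OF archY that] by metis
  then obtain p q where pq: "\<And>y. dominated y \<Longrightarrow> dominated (p y)" "\<And>y. dominated y \<Longrightarrow> dominated (q y)"
    "\<And>y. dominated y \<Longrightarrow> y = p y + q y" "\<And>y. dominated y \<Longrightarrow> vdisj (p y) (q y)"
    "\<And>y. dominated y \<Longrightarrow> vdisj (T (p y)) (T (q y))"
    by metis
  define y where "y n = (p ^^ n) b" for n
  define g where "g n = q (y n)" for n
  have y_Suc: "y (Suc n) = p (y n)" for n
    by (simp add: y_def)
  have Dy: "dominated (y n)" for n
    by (induction n) (use b pq(1) in \<open>simp_all add: y_def\<close>)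
  have split: "y n = y (Suc n) + g n" "vdisj (y (Suc n)) (g n)" "vdisj (T (y (Suc n))) (T (g n))" for n
    unfolding y_Suc g_def by (rule pq[OF Dy])+
  have sum: "vabs (y n) = vabs (y (Suc n)) + vabs (g n)" for n
    by (subst split(1)) (rule vabs_add_disjoint[OF split(2)])
  have y_Suc_le: "vabs (y (Suc n)) \<le> vabs (y n)" and g_le_y: "vabs (g n) \<le> vabs (y n)" for n
    using sum[of n] by simp_all
  have y_mono: "vabs (y m) \<le> vabs (y n)" if "n \<le> m" for m n
    using that by (induction m rule: dec_induct) (auto intro: order_trans[OF y_Suc_le])
  have g_le: "vabs (g k) \<le> vabs (y n)" if "n \<le> k" for n k
    using g_le_y y_mono[OF that] by (rule order_trans)
  have y0: "y 0 = b"
    by (simp add: y_def)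
  have disj_less: "vdisj (g k) (g n) \<and> vdisj (T (g k)) (T (g n))" if "n < k" for k n
  proof -
    have "vabs (g k) \<le> 1 *\<^sub>R vabs (y (Suc n))" "vabs (g n) \<le> 1 *\<^sub>R vabs (g n)"
      using g_le[of "Suc n" k] that by simp_all
    then show ?thesis
      using split(2,3)[of n] vdisj_images vdisj_le_scaleR by blast
  qed
  have disj: "vdisj (g k) (g n)" "vdisj (T (g k)) (T (g n))" if "k \<noteq> n" for k n
    using disj_less[of n k] disj_less[of k n] that by (auto simp: vdisj_commute neq_iff)
  have telescope: "b = y n + (\<Sum>k<n. g k)" for n
  proof (induction n)
    case (Suc n)
    then show ?case
      using split(1)[of n] by (simp add: algebra_simps)
  qed (simp add: y0)
  \<comment> \<open>The single element \<open>b - g n\<close> gathers all other pieces: the earlier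
    ones in the sum, the later ones inside \<open>y (Suc n)\<close>. Condition (beta) can then be
    applied to one band.\<close>
  have rest: "b - g n = y (Suc n) + (\<Sum>k<n. g k)" for n
    using telescope[of n] split(1)[of n] by (simp add: algebra_simps)
  have rest_disj: "vdisj (b - g n) (g n)" "vdisj (T (b - g n)) (T (g n))" for n
    unfolding rest linear_add[OF lin] linear_sum[OF lin]
    by (intro vdisj_add vdisj_sum split disj; simp)+
  have rest_le: "vabs (g k) \<le> vabs (b - g n)" if "k \<noteq> n" for k n
  proof (rule vabs_le_of_disjoint)
    have "vabs (g k) \<le> vabs b"
      using g_le[of 0 k] by (simp add: y0)
    also have "\<dots> \<le> vabs (b - g n) + vabs (g n)"
      using vabs_triangle[of "b - g n" "g n"] by simp
    finally show "vabs (g k) \<le> vabs (b - g n) + vabs (g n)" .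
  qed (rule disj(1)[OF that])
  have "\<forall>n. \<exists>f. vabs f \<le> vabs (g n) \<and> 4 ^ n < N (T f)"
    using unbounded[OF pq(2)[OF Dy]] by (simp add: g_def)
  then obtain f where f: "\<And>n. vabs (f n) \<le> vabs (g n)" "\<And>n. 4 ^ n < N (T (f n))"
    by metis
  have "\<exists>n. N (T (f n)) < 4 ^ n"
  proof (rule gliding_hump[OF archX ru N lin])
    show "vabs (f n) \<le> vabs b" for n
      using order_trans[OF f(1) g_le[of 0 n]] by (simp add: y0)
    show "vdisj (T h) (T (f n))" if h: "\<And>z. (\<And>k. k \<noteq> n \<Longrightarrow> vdisj (f k) z) \<Longrightarrow> vdisj h z" for n h
    proof -
      have "vdisj h z" if "vdisj (b - g n) z" for z
        using h vdisj_mono[OF that order_trans[OF f(1) rest_le]] by blast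
      then have "band_le h (b - g n)"
        unfolding band_le_iff using vdisj_sym by blast
      then have "band_le (T h) (T (b - g n))"
        using beta by (simp add: condition_beta_def)
      moreover have "band_le (T (f n)) (T (g n))"
        using f(1) by (intro band_le_image[of _ 1]) simp
      ultimately show ?thesis
        using rest_disj(2)[of n] band_leD vdisj_sym by blast
    qed
  qed
  then show False
    using f(2) by (meson not_less_iff_gr_or_eq)
qed

text \<open>The binary digits of \<open>T a / T b \<in> [0, 1]\<close> are indicators of components of \<open>b\<close>. Each step
  doubles and subtracts the digit.\<close>

lemma binary_digit:
  assumes disj: "vdisj a b" and g: "vdisj g a" "same_sign g b"
    and x: "x = m *\<^sub>R a - g" and Tx: "0 \<le> T x" "T x \<le> T b"
  obtains b' where "vabs b' \<le> vabs b" "vdisj (2 *\<^sub>R g + b') a" "same_sign (2 *\<^sub>R g + b') b"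
    "0 \<le> T (2 *\<^sub>R x - b')" "T (2 *\<^sub>R x - b') \<le> T b"
proof -
  \<comment> \<open>The first digit is 1 where \<open>T x\<close> exceeds half of
    \<open>T b\<close>, that is, on the positive part of \<open>w\<close>. The digit becomes the
    component \<open>b1\<close> of \<open>b\<close> along \<open>c\<close>.\<close>
  define w where "w = T (2 *\<^sub>R x - b)"
  obtain c d where cd: "vdisj c d" "2 *\<^sub>R x - b = c - d" "T c = sup w 0" "T d = sup (- w) 0"
    unfolding w_def by (rule split_image)
  have Tcd: "vdisj (T c) (T d)"
    unfolding cd(3,4) by (rule vdisj_pos_neg)
  have g2: "same_sign (2 *\<^sub>R g) b" "vdisj (2 *\<^sub>R g) a"
    using same_sign_add[OF g(2,2)] vdisj_add[OF g(1,1)] by (simp_all add: scaleR_2)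
  \<comment> \<open>To split \<open>b\<close> along \<open>c\<close> and \<open>d\<close> it must be
    dominated by \<open>2 x - b\<close>, which is \<open>2 m a - (2 g + b)\<close>. Disjointness
    from \<open>a\<close> rules out cancellation with \<open>a\<close>, and agreement of signs rules
    it out between \<open>g\<close> and \<open>b\<close>.\<close>
  have "vdisj (2 *\<^sub>R g + b) ((2 * m) *\<^sub>R a)"
    by (intro vdisj_scaleR_right vdisj_add g2 vdisj_sym[OF disj])
  then have "vabs (2 *\<^sub>R g + b) \<le> vabs ((2 *\<^sub>R g + b) - (2 * m) *\<^sub>R a)"
    by (simp add: vabs_diff_disjoint)
  also have "(2 *\<^sub>R g + b) - (2 * m) *\<^sub>R a = - (c - d)"
    unfolding cd(2)[symmetric] x by (simp add: algebra_simps)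
  finally have "vabs (2 *\<^sub>R g + b) \<le> vabs (c - d)"
    by (simp only: vabs_minus)
  with same_sign_vabs_le[OF g2(1)] have "vabs b \<le> 1 *\<^sub>R vabs (c - d)"
    by simp
  then obtain b1 b2 where b: "b = b1 + b2" "vabs b1 \<le> 1 *\<^sub>R vabs c" "vabs b2 \<le> 1 *\<^sub>R vabs d"
    "vabs b1 \<le> vabs b" "vabs b2 \<le> vabs b" "vdisj b1 b2"
    by (rule disjoint_component[OF cd(1)]) simp
  have refl_le: "vabs c \<le> 1 *\<^sub>R vabs c" "vabs d \<le> 1 *\<^sub>R vabs d"
    by simp_all
  have dis: "vdisj (T b1) (T b2)" "vdisj (T c) (T b2)" "vdisj (T b1) (T d)" "vdisj (T c) (T d)"
    by (rule vdisj_images[OF _ _ Tcd]; fact b refl_le)+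
  have Tb: "T b = T b1 + T b2"
    by (simp add: b(1) linear_add[OF lin])
  have "T c - T d = w"
    unfolding cd(3,4) by (rule pos_minus_neg)
  then have w: "2 *\<^sub>R T x - T b1 - T b2 = T c - T d"
    by (simp add: w_def linear_diff[OF lin] linear_scale[OF lin] Tb algebra_simps)
  have "0 \<le> T b2 - T d"
  \<comment> \<open>The nonnegative \<open>2 T x\<close> is regrouped into its parts off and on the
    region of digit 1. The same is done below with \<open>2 (T b - T x)\<close>.\<close>
  proof (rule vdisj_nonneg_addD)
    show "vdisj (T b2 - T d) (T c + T b1)"
      using dis dis(2)[THEN vdisj_sym] dis(1)[THEN vdisj_sym] dis(3,4)[THEN vdisj_sym]
      by (simp add: vdisj_diff vdisj_add_right)
    have "(T b2 - T d) + (T c + T b1) = 2 *\<^sub>R T x"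
      using w by (simp add: algebra_simps)
    then show "0 \<le> (T b2 - T d) + (T c + T b1)"
      using Tx by (simp add: scaleR_nonneg_nonneg)
  qed
  moreover have "0 \<le> T c" "0 \<le> T d"
    by (simp_all add: cd(3,4))
  moreover have "2 *\<^sub>R T x - T b1 = T c + (T b2 - T d)"
    using w by (simp add: algebra_simps)
  ultimately have 1: "0 \<le> 2 *\<^sub>R T x - T b1"
    by (simp add: add_nonneg_nonneg)
  have "0 \<le> T b1 - T c"
  proof (rule vdisj_nonneg_addD)
    show "vdisj (T b1 - T c) (T b2 + T d)"
      using dis by (simp add: vdisj_diff vdisj_add_right)
    have "(T b1 - T c) + (T b2 + T d) = 2 *\<^sub>R (T b - T x)"
      using w by (simp add: Tb scaleR_2 algebra_simps)
    then show "0 \<le> (T b1 - T c) + (T b2 + T d)"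
      using Tx by (simp add: scaleR_nonneg_nonneg)
  qed
  moreover have "T b - (2 *\<^sub>R T x - T b1) = (T b1 - T c) + T d"
    using w by (simp add: Tb algebra_simps)
  ultimately have 2: "0 \<le> T b - (2 *\<^sub>R T x - T b1)"
    using \<open>0 \<le> T d\<close> by (metis add_nonneg_nonneg)
  show ?thesis
  proof
    show "vdisj (2 *\<^sub>R g + b1) a"
      using g2(2) vdisj_mono[OF vdisj_sym[OF disj] b(4)] by (rule vdisj_add)
    show "same_sign (2 *\<^sub>R g + b1) b"
      using g2(1) same_sign_component[OF b(1,6)] by (rule same_sign_add)
    show "0 \<le> T (2 *\<^sub>R x - b1)" "T (2 *\<^sub>R x - b1) \<le> T b"
      using 1 2 by (simp_all add: linear_diff[OF lin] linear_scale[OF lin])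
  qed fact
qed

text \<open>The expansion error has two parts. The images of the remainders \<open>x n\<close> stay
  in \<open>[0, T b]\<close>, and the tails of the digit series are small multiples of elements of
  \<open>[- \<bar>b\<bar>, \<bar>b\<bar>]\<close>, where \<open>T\<close> is bounded. Injectivity
  then makes \<open>a\<close> equal to a series in the band of \<open>b\<close>.\<close>

lemma bounded_not_dominated:
  assumes arch: "archimedean_vl TYPE('a)" and ru: "ru_complete TYPE('a)" and N: "lattice_norm N"
    and bounded: "\<And>f. vabs f \<le> vabs b \<Longrightarrow> N (T f) \<le> K"
  shows "\<not> dominated b"
proof
  assume "dominated b"
  then obtain a where a: "vdisj a b" "a \<noteq> 0" "0 \<le> T a" "T a \<le> T b"
    unfolding dominated_def by blast
  \<comment> \<open>The invariant of the remainders: besides the bounds on the image,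
    \<open>x\<close> is a multiple of \<open>a\<close> minus an accumulated sum of digits that is
    disjoint from \<open>a\<close> and has the signs of \<open>b\<close>.\<close>
  define I where "I x \<longleftrightarrow> 0 \<le> T x \<and> T x \<le> T b \<and>
    (\<exists>m g. x = m *\<^sub>R a - g \<and> vdisj g a \<and> same_sign g b)" for x
  have "\<exists>b'. vabs b' \<le> vabs b \<and> I (2 *\<^sub>R x - b')" if Ix: "I x" for x
  proof -
    obtain m g where x: "0 \<le> T x" "T x \<le> T b" "x = m *\<^sub>R a - g" "vdisj g a" "same_sign g b"
      using Ix unfolding I_def by blast
    obtain b' where b': "vabs b' \<le> vabs b" "vdisj (2 *\<^sub>R g + b') a" "same_sign (2 *\<^sub>R g + b') b"
      "0 \<le> T (2 *\<^sub>R x - b')" "T (2 *\<^sub>R x - b') \<le> T b"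
      by (rule binary_digit[OF a(1) x(4,5,3,1,2)])
    have "2 *\<^sub>R x - b' = (2 * m) *\<^sub>R a - (2 *\<^sub>R g + b')"
      by (simp add: x(3) algebra_simps)
    then have "I (2 *\<^sub>R x - b')"
      unfolding I_def using b' by blast
    then show ?thesis
      using b'(1) by blast
  qed
  then obtain digit where digit: "\<And>x. I x \<Longrightarrow> vabs (digit x) \<le> vabs b" "\<And>x. I x \<Longrightarrow> I (2 *\<^sub>R x - digit x)"
    by metis
  define x where "x n = ((\<lambda>x. 2 *\<^sub>R x - digit x) ^^ n) a" for n
  define d where "d n = digit (x n)" for n
  have x_Suc: "x (Suc n) = 2 *\<^sub>R x n - d n" for n
    by (simp add: x_def d_def)
  have "a = 1 *\<^sub>R a - 0" "same_sign 0 b"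
    by (simp_all add: same_sign_def)
  then have "I a"
    unfolding I_def using a vdisj_zero(1) by blast
  then have Ix: "I (x n)" for n
    by (induction n) (simp_all add: x_def digit)
  have d: "vabs (d n) \<le> vabs b" for n
    unfolding d_def using Ix by (rule digit)
  obtain l where l: "\<And>n. vabs (l - (\<Sum>k<n. (1/2) ^ k *\<^sub>R d k)) \<le> (2 * (1/2) ^ n) *\<^sub>R vabs b"
    by (rule ru_complete_geometric[OF arch ru, of d "vabs b", OF d]) (blast intro: that)
  \<comment> \<open>The factor \<open>1/2\<close> appears because the first binary digit has weight
    \<open>1/2\<close>, while the geometric series starts with weight 1.\<close>
  have expansion: "a = (1/2) ^ n *\<^sub>R x n + (1/2) *\<^sub>R (\<Sum>k<n. (1/2) ^ k *\<^sub>R d k)" for n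
  proof (induction n)
    case (Suc n)
    have "x n = (1/2) *\<^sub>R (x (Suc n) + d n)"
      by (simp add: x_Suc)
    then have "(1/2) ^ n *\<^sub>R x n = (1/2) ^ Suc n *\<^sub>R x (Suc n) + (1/2) *\<^sub>R ((1/2) ^ n *\<^sub>R d n)"
      by (simp add: scaleR_add_right)
    with Suc.IH show ?case
      by (simp add: scaleR_add_right)
  qed (simp add: x_def)
  have small: "N (T (a - (1/2) *\<^sub>R l)) \<le> (N (T b) + K) * (1/2) ^ n" for n
  proof -
    define r where "r = l - (\<Sum>k<n. (1/2) ^ k *\<^sub>R d k)"
    \<comment> \<open>The scaling turns the tail estimate \<open>2 * (1/2) ^ n\<close> into exactly
      \<open>vabs b\<close>, so that \<open>bounded\<close> applies.\<close>
    have "vabs ((2 ^ n / 2) *\<^sub>R r) \<le> (2 ^ n / 2) *\<^sub>R ((2 * (1/2) ^ n) *\<^sub>R vabs b)"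
      using l[of n] unfolding vabs_scaleR r_def by (intro scaleR_mono) simp_all
    also have "\<dots> = vabs b"
      by (simp add: power_divide)
    finally have "N (T ((2 ^ n / 2) *\<^sub>R r)) \<le> K"
      by (rule bounded)
    then have r: "N (T r) * (1/2) \<le> K * (1/2) ^ n"
      by (simp add: linear_scale[OF lin] lattice_norm_scaleR[OF N] field_simps)
    have "0 \<le> T (x n)" "T (x n) \<le> T b"
      using Ix[of n] by (simp_all add: I_def)
    then have xn: "N (T (x n)) \<le> N (T b)"
      by (intro lattice_norm_mono[OF N]) (simp add: vabs_of_nonneg order_trans[of 0 "T (x n)" "T b"])
    have "a - (1/2) *\<^sub>R l = (1/2) ^ n *\<^sub>R x n - (1/2) *\<^sub>R r"
      by (subst expansion[of n]) (simp add: r_def algebra_simps)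
    then have "N (T (a - (1/2) *\<^sub>R l)) \<le> N ((1/2) ^ n *\<^sub>R T (x n)) + N ((1/2) *\<^sub>R T r)"
      using lattice_norm_triangle_diff[OF N] by (simp add: linear_diff[OF lin] linear_scale[OF lin])
    also have "\<dots> = N (T (x n)) * (1/2) ^ n + N (T r) * (1/2)"
      by (simp add: lattice_norm_scaleR[OF N])
    also have "\<dots> \<le> N (T b) * (1/2) ^ n + K * (1/2) ^ n"
      using xn r by (intro add_mono mult_right_mono) simp_all
    finally show ?thesis
      by (simp add: distrib_right)
  qed
  have "N (T (a - (1/2) *\<^sub>R l)) \<le> 0"
  proof (rule ccontr)
    assume "\<not> ?thesis"
    then obtain n where "(N (T b) + K) * (1/2) ^ n < N (T (a - (1/2) *\<^sub>R l))"
      using half_power_small[of "N (T (a - (1/2) *\<^sub>R l))" 0 "N (T b) + K"] by (metis not_le)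
    with small[of n] show False
      by simp
  qed
  then have "T (a - (1/2) *\<^sub>R l) = 0"
    by (rule lattice_norm_le_0_imp[OF N])
  then have al: "a = (1/2) *\<^sub>R l"
    by (simp add: image_eq_0_iff)
  \<comment> \<open>For \<open>n = 0\<close> the partial sum is empty and \<open>l\<close> is
    bounded by \<open>2 \<bar>b\<bar>\<close>, hence disjoint from \<open>a\<close>, although
    \<open>a\<close> is half of \<open>l\<close>.\<close>
  have "vdisj l a"
    using vdisj_le_scaleR[OF vdisj_sym[OF a(1)], of l 2] l[of 0] by simp
  then have "vdisj ((1/2) *\<^sub>R l) a"
    by (rule vdisj_scaleR)
  then show False
    using a(2) al by simp
qed

text \<open>Cut disjoint \<open>a\<close> and \<open>b\<close> where \<open>T a\<close> and
  \<open>T b\<close> cross. On the side where \<open>T a\<close> is smaller, a nonzero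
  \<open>a2\<close> would make \<open>b2\<close> dominated. On the other side a nonzero
  \<open>b1\<close> would make \<open>a1\<close> dominated. What remains is \<open>a1\<close> and
  \<open>b2\<close>, whose images are disjoint.\<close>

lemma condition_beta_imp_dp:
  assumes archX: "archimedean_vl TYPE('a)" and archY: "archimedean_vl TYPE('b)"
    and ru: "ru_complete TYPE('a)" and N: "lattice_norm (N :: 'b \<Rightarrow> real)"
  shows "disjointness_preserving T"
proof -
  have none: "\<not> dominated b" for b
    using dominated_bounded[OF archX archY ru N] bounded_not_dominated[OF archX ru N] by metis
  have lin': "linear (inv T)"
    by (rule linear_inv[OF lin bij])
  have dp': "disjointness_preserving (inv T)"
    unfolding disjointness_preserving_def
    using reflects_disjoint bij by (metis bij_is_surj surj_f_inv_f)
  show ?thesis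
    unfolding disjointness_preserving_def
  proof (intro allI impI)
    fix x y :: 'a assume xy: "vdisj x y"
    define a b where "a = inv T (vabs (T x))" and "b = inv T (vabs (T y))"
    have Tab: "T a = vabs (T x)" "T b = vabs (T y)"
      using bij by (simp_all add: a_def b_def bij_is_surj surj_f_inv_f)
    \<comment> \<open>The inverse preserves disjointness because \<open>T\<close> reflects it, so
      replacing \<open>T x\<close> by its absolute value does not change the absolute value of the
      preimage.\<close>
    have "vabs a = vabs x" "vabs b = vabs y"
      using bij by (simp_all add: a_def b_def dp_vabs[OF lin' dp'] bij_is_inj)
    then have ab: "vdisj a b"
      using xy by (simp add: vdisj_def)
    obtain c d where cd: "vdisj c d" "a - b = c - d" "T c = sup (T (a - b)) 0" "T d = sup (- T (a - b)) 0"
      by (rule split_image)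
    have Tcd: "vdisj (T c) (T d)"
      unfolding cd(3,4) by (rule vdisj_pos_neg)
    have sum: "vabs (c - d) = vabs a + vabs b"
      using vabs_diff_disjoint[OF ab] by (simp add: cd(2))
    have "vabs a \<le> 1 *\<^sub>R vabs (c - d)" "vabs b \<le> 1 *\<^sub>R vabs (c - d)"
      by (simp_all add: sum)
    from this(1) obtain a1 a2 where a: "a = a1 + a2" "vabs a1 \<le> 1 *\<^sub>R vabs c" "vabs a2 \<le> 1 *\<^sub>R vabs d"
      "vabs a1 \<le> vabs a" "vabs a2 \<le> vabs a" "vdisj a1 a2"
      by (rule disjoint_component[OF cd(1)]) simp
    from \<open>vabs b \<le> 1 *\<^sub>R vabs (c - d)\<close>
    obtain b1 b2 where b: "b = b1 + b2" "vabs b1 \<le> 1 *\<^sub>R vabs c" "vabs b2 \<le> 1 *\<^sub>R vabs d"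
      "vabs b1 \<le> vabs b" "vabs b2 \<le> vabs b" "vdisj b1 b2"
      by (rule disjoint_component[OF cd(1)]) simp
    have ab': "vdisj a2 b2" "vdisj b1 a1"
      using vdisj_mono[OF vdisj_sym[OF vdisj_mono[OF ab a(4)]] b(4)]
        vdisj_mono[OF vdisj_sym[OF vdisj_mono[OF ab a(5)]] b(5)] by (simp_all add: vdisj_commute)
    have refl_le: "vabs c \<le> 1 *\<^sub>R vabs c" "vabs d \<le> 1 *\<^sub>R vabs d"
      by simp_all
    have dis: "vdisj (T a1) (T a2)" "vdisj (T b1) (T b2)" "vdisj (T a1) (T b2)" "vdisj (T b1) (T a2)"
      "vdisj (T c) (T a2)" "vdisj (T c) (T b2)" "vdisj (T a1) (T d)" "vdisj (T b1) (T d)"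
      by (rule vdisj_images[OF _ _ Tcd]; fact a b refl_le)+
    have pos: "0 \<le> T a2" "0 \<le> T b1"
    proof -
      have "T a2 + T a1 = vabs (T x)" "T b1 + T b2 = vabs (T y)"
        by (simp_all add: a(1) b(1) linear_add[OF lin] flip: Tab)
      then show "0 \<le> T a2" "0 \<le> T b1"
        using vdisj_nonneg_addD[OF vdisj_sym[OF dis(1)]] vdisj_nonneg_addD[OF dis(2)] by simp_all
    qed
    have "T c - T d = T a - T b"
      unfolding cd(3,4) pos_minus_neg by (rule linear_diff[OF lin])
    \<comment> \<open>The identity \<open>T c - T d = T a - T b\<close> becomes a sum of two
      disjoint elements equal to 0, so sign information holds for each of them separately.\<close>
    then have eq: "(T a1 - T b1 - T c) + (T a2 - T b2 + T d) = 0" "(T b2 - T a2 - T d) + (T b1 - T a1 + T c) = 0"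
      by (simp_all add: a(1) b(1) linear_add[OF lin] algebra_simps)
    have disA: "vdisj (T a1 - T b1 - T c) (T a2 - T b2 + T d)"
      using dis Tcd by (simp add: vdisj_diff vdisj_diff_right vdisj_add_right)
    have "0 \<le> T a1 - T b1 - T c"
      using vdisj_nonneg_addD[OF disA] eq(1) by simp
    moreover have "vdisj (T b2 - T a2 - T d) (T b1 - T a1 + T c)"
    proof -
      have "vdisj (- (T a2 - T b2 + T d)) (- (T a1 - T b1 - T c))"
        using disA by (simp only: vdisj_minus vdisj_commute)
      then show ?thesis
        by (simp add: algebra_simps)
    qed
    then have "0 \<le> T b2 - T a2 - T d"
      by (rule vdisj_nonneg_addD) (simp add: eq(2))
    moreover have "0 \<le> T c" "0 \<le> T d"
      by (simp_all add: cd(3,4))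
    ultimately have "T b1 \<le> T a1" "T a2 \<le> T b2"
      by (simp_all add: le_diff_eq) (meson add_increasing order_trans le_add_same_cancel2)+
    then have "a2 = 0" "b1 = 0"
      using none[of b2] none[of a1] ab' pos unfolding dominated_def by blast+
    then have "vdisj (T a) (T b)"
      using dis(3) a(1) b(1) by simp
    then show "vdisj (T x) (T y)"
      by (simp add: Tab)
  qed
qed

end

section \<open>The equivalence under each set of hypotheses\<close>

lemma dp_inv_iff:
  assumes "bij T"
  shows "disjointness_preserving (inv T) \<longleftrightarrow> (\<forall>x y. vdisj (T x) (T y) \<longrightarrow> vdisj x y)"
  using assms unfolding disjointness_preserving_def
  by (metis bij_is_inj bij_is_surj inv_f_f surj_f_inv_f)

lemma dp_iff_beta_ru_normed:
  fixes T :: "'a::{ordered_real_vector, lattice} \<Rightarrow> 'b::{ordered_real_vector, lattice}"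
  assumes arch: "archimedean_vl TYPE('a)" "archimedean_vl TYPE('b)" and T: "linear T" "bij T"
    and ru: "ru_complete TYPE('a)" and N: "lattice_norm (N :: 'b \<Rightarrow> real)"
  shows "disjointness_preserving T \<longleftrightarrow> condition_beta T"
proof
  assume dp: "disjointness_preserving T"
  show "condition_beta T"
    using dp_reflects_disjoint[OF arch(1) ru N T(1) bij_is_inj[OF T(2)] dp]
    by (rule disjointness_preserving_imp_condition_beta[OF dp bij_is_surj[OF T(2)]])
qed (rule condition_beta_imp_dp[OF T _ arch ru N])

text \<open>The inverse maps a relatively uniformly complete lattice onto a normed one, so the two
  facts apply to it. For a \<open>T\<close> preserving disjointness, band projections give the
  inverse condition (beta), so it preserves disjointness and \<open>T\<close> reflects it.
  Conversely, condition (beta) for \<open>T\<close> makes the inverse preserve and hence reflect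
  disjointness.\<close>

lemma dp_iff_beta_sigma_complete:
  fixes T :: "'a::{ordered_real_vector, lattice} \<Rightarrow> 'b::{ordered_real_vector, lattice}"
  assumes arch: "archimedean_vl TYPE('a)" "archimedean_vl TYPE('b)" and lin: "linear T" and bij: "bij T"
    and sc: "dedekind_sigma_complete TYPE('a)" and N: "lattice_norm (N :: 'a \<Rightarrow> real)"
    and ru: "ru_complete TYPE('b)"
  shows "disjointness_preserving T \<longleftrightarrow> condition_beta T"
proof
  have inv: "linear (inv T)" "bij (inv T)" "inv (inv T) = T"
    using lin bij by (simp_all add: linear_inv bij_imp_bij_inv inv_inv_eq)
  {
    assume dp: "disjointness_preserving T"
    then have "condition_beta (inv T)"
      by (rule sigma_complete_inverse_beta[OF sc lin bij])
    then have "disjointness_preserving (inv T)"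
      by (rule condition_beta_imp_dp[OF inv(1,2) _ arch(2,1) ru N])
    then show "condition_beta T"
      using disjointness_preserving_imp_condition_beta[OF dp bij_is_surj[OF bij]]
      by (simp add: dp_inv_iff[OF bij])
  next
    assume "condition_beta T"
    then have dp: "disjointness_preserving (inv T)"
      using condition_beta_reflects_disjoint[OF lin bij_is_inj[OF bij]] by (simp add: dp_inv_iff[OF bij])
    have "disjointness_preserving (inv (inv T))"
      using dp_reflects_disjoint[OF arch(2) ru N inv(1) bij_is_inj[OF inv(2)] dp]
      by (simp only: dp_inv_iff[OF inv(2)]) blast
    then show "disjointness_preserving T"
      by (simp only: inv(3))
  }
qed

theorem theorem3p7:
  fixes T :: "'a::{ordered_real_vector, lattice} \<Rightarrow> 'b::{ordered_real_vector, lattice}"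
    and NX :: "'a \<Rightarrow> real" and NY :: "'b \<Rightarrow> real"
  assumes archX: "archimedean_vl TYPE('a)"
    and archY: "archimedean_vl TYPE('b)"
    and lin: "linear T"
    and bij: "bij T"
    and cases:
      "(banach_lattice_norm NX \<and> banach_lattice_norm NY)
       \<or> (ru_complete TYPE('a) \<and> lattice_norm NY)
       \<or> (dedekind_sigma_complete TYPE('a) \<and> lattice_norm NX \<and> ru_complete TYPE('b))
       \<or> (dedekind_sigma_complete TYPE('a) \<and> lattice_norm NX \<and> (\<exists>J::'a \<Rightarrow> 'b. riesz_iso J))"
  shows "disjointness_preserving T \<longleftrightarrow> condition_beta T"
proof -
  \<comment> \<open>Banach lattices fall under the first alternative. If \<open>Y\<close> is a copy
    of \<open>X\<close>, then \<open>Y\<close> inherits relatively uniform completeness from the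
    \<sigma>-complete \<open>X\<close>, which is the second.\<close>
  consider "ru_complete TYPE('a)" "lattice_norm NY"
    | "dedekind_sigma_complete TYPE('a)" "lattice_norm NX" "ru_complete TYPE('b)"
    using cases banach_imp_ru_complete[of NX] sigma_complete_imp_ru_complete riesz_iso_ru_complete
    by (auto simp: banach_lattice_norm_def)
  then show ?thesis
  proof cases
    case 1
    then show ?thesis
      by (rule dp_iff_beta_ru_normed[OF archX archY lin bij])
  next
    case 2
    then show ?thesis
      by (rule dp_iff_beta_sigma_complete[OF archX archY lin bij])
  qed
qed

end
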